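(* For any $\Phi\in D(A)$ the backward problem with $f\equiv0$, $$\sum_{j=1}^{M} q_j\,\partial_t^{\rho_j}u(t)+Au(t)=0,\quad 0<t<T,\qquad u(T)=\Phi,$$ has a unique solution $u$. Moreover, there exist constants $C_1,C_2>0$ such that $$C_1\|u(0)\|\le\|u(T)\|_1\le C_2\|u(0)\|.$$
   Context: $H$ is a separable Hilbert space with inner product $(\cdot,\cdot)$ and norm $\|\cdot\|$. $A$ is a positive self-adjoint operator in $H$ with domain $D(A)$ and compact inverse $A^{-1}$. Hence $A$ has a complete orthonormal system of eigenfunctions $\{v_k\}_{k\ge1}$ with eigenvalues $0<\lambda_1\le\lambda_2\le\cdots\to+\infty$. For $g\in D(A)$, with $g_k=(g,v_k)$, put $\|g\|_1=\|Ag\|=\big(\sum_{k=1}^\infty\lambda_k^{2}|g_k|^2\big)^{1/2}$. $T>0$, $M\ge1$ is an integer, $0<\rho_M<\rho_{M-1}<\cdots<\rho_1<1$, $q_j>0$ for $j=1,\dots,M$, and $q_1=1$. The Caputo derivative of order $\rho_j$ is $$\partial_t^{\rho_j}h(t)=\frac{1}{\Gamma(1-\rho_j)}\int_0^t\frac{h'(s)}{(t-s)^{\rho_j}}\,ds,\quad t>0,$$ provided the right-hand side exists. The data $H$, $A$, $M$, $\rho_j$, $q_j$, $T$ are fixed; the constants $C_1,C_2$ do not depend on $\Phi$ or $u$. A solution is a function $u\in C([0,T];H)$ such that for $0<t<T$ one has $u(t)\in D(A)$, the derivatives $\partial_t^{\rho_j}u(t)$ exist in $H$, and the equation holds in $H$,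 and such that the final condition $u(T)=\Phi$ holds. *)

theory Defs
  imports "HOL-Analysis.Analysis"
begin

text \<open>
  The Hilbert space is a type of class \<open>real_inner\<close>, \<open>complete_space\<close>,
  \<open>second_countable_topology\<close> (for metric spaces, second countable means separable). A complex
  Hilbert space is covered by restricting scalars and using the real part of its inner product:
  norms, self-adjointness, positivity and compactness are unaffected.

  An unbounded operator is a pair of its domain \<open>D\<close> and a function \<open>A\<close>, whose values outside \<open>D\<close>
  are irrelevant.
\<close>

definition linear_operator :: "'h::real_vector set \<Rightarrow> ('h \<Rightarrow> 'h) \<Rightarrow> bool" where
  "linear_operator D A \<longleftrightarrow> subspace D \<and>
     (\<forall>x\<in>D. \<forall>y\<in>D. A (x + y) = A x + A y) \<and> (\<forall>c. \<forall>x\<in>D. A (c *\<^sub>R x) = c *\<^sub>R A x)"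

definition adjoint_graph :: "'h::real_inner set \<Rightarrow> ('h \<Rightarrow> 'h) \<Rightarrow> ('h \<times> 'h) set" where
  "adjoint_graph D A = {(y, z). \<forall>x\<in>D. A x \<bullet> y = x \<bullet> z}"

text \<open>Equality of the graphs of the operator and its adjoint includes equality of the domains.\<close>

definition self_adjoint_operator :: "'h::real_inner set \<Rightarrow> ('h \<Rightarrow> 'h) \<Rightarrow> bool" where
  "self_adjoint_operator D A \<longleftrightarrow> linear_operator D A \<and> closure D = UNIV \<and>
     adjoint_graph D A = {(x, A x) | x. x \<in> D}"

definition positive_operator :: "'h::real_inner set \<Rightarrow> ('h \<Rightarrow> 'h) \<Rightarrow> bool" where
  "positive_operator D A \<longleftrightarrow> (\<forall>x\<in>D. x \<noteq> 0 \<longrightarrow> A x \<bullet> x > 0)"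

definition has_compact_inverse :: "'h::real_normed_vector set \<Rightarrow> ('h \<Rightarrow> 'h) \<Rightarrow> bool" where
  "has_compact_inverse D A \<longleftrightarrow> bij_betw A D UNIV \<and>
     (\<forall>S. bounded S \<longrightarrow> compact (closure (inv_into D A ` S)))"

text \<open>
  The derivative in the Caputo integral is the strong derivative, required at every point of the
  open interval. The integral is the Henstock-Kurzweil integral of a vector-valued function, so
  that convergent improper integrals are allowed. Bochner integrability would be too restrictive:
  if the initial value is an arbitrary vector of the Hilbert space, the derivative of the solution
  need not be absolutely integrable at the origin.
\<close>

definition caputo_integrand :: "real \<Rightarrow> (real \<Rightarrow> 'h::real_normed_vector) \<Rightarrow> real \<Rightarrow> real \<Rightarrow> 'h" where
  "caputo_integrand \<rho> h t s = vector_derivative h (at s) /\<^sub>R ((t - s) powr \<rho>)"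

definition caputo_deriv_exists :: "real \<Rightarrow> (real \<Rightarrow> 'h::real_normed_vector) \<Rightarrow> real \<Rightarrow> bool" where
  "caputo_deriv_exists \<rho> h t \<longleftrightarrow>
     (\<forall>s\<in>{0<..<t}. h differentiable (at s)) \<and> caputo_integrand \<rho> h t integrable_on {0..t}"

definition caputo_deriv :: "real \<Rightarrow> (real \<Rightarrow> 'h::real_normed_vector) \<Rightarrow> real \<Rightarrow> 'h" where
  "caputo_deriv \<rho> h t = (1 / Gamma (1 - \<rho>)) *\<^sub>R integral {0..t} (caputo_integrand \<rho> h t)"

text \<open>Only the values of \<open>u\<close> on \<open>{0..T}\<close> matter.\<close>

definition backward_solution ::
  "'h::real_normed_vector set \<Rightarrow> ('h \<Rightarrow> 'h) \<Rightarrow> nat \<Rightarrow> (nat \<Rightarrow> real) \<Rightarrow> (nat \<Rightarrow> real) \<Rightarrow> real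
    \<Rightarrow> 'h \<Rightarrow> (real \<Rightarrow> 'h) \<Rightarrow> bool" where
  "backward_solution D A M \<rho> q T \<Phi> u \<longleftrightarrow>
     continuous_on {0..T} u \<and>
     (\<forall>t\<in>{0<..<T}. u t \<in> D \<and>
        (\<forall>j\<in>{1..M}. caputo_deriv_exists (\<rho> j) u t) \<and>
        (\<Sum>j=1..M. q j *\<^sub>R caputo_deriv (\<rho> j) u t) + A (u t) = 0) \<and>
     u T = \<Phi>"

end

theory Submission
  imports Defs
begin

text \<open>
  The inverse of \<open>A\<close> is compact, symmetric and positive, so the space has an orthonormal basis of
  eigenvectors \<open>b\<close> of \<open>A\<close>, with eigenvalues \<open>lam b\<close> that stay above some \<open>l0 > 0\<close>. Along \<open>b\<close> the
  evolution equation becomes the scalar relaxation equation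
  \<open>(\<Sum>j. q j * caputo_deriv (\<rho> j) h t) + lam b * h t = 0\<close>. For each \<open>lam > 0\<close> this equation has exactly
  one solution \<open>relax lam\<close> with value 1 at 0, hence every solution \<open>u\<close> satisfies
  \<open>u t \<bullet> b = (u 0 \<bullet> b) * relax (lam b) t\<close>. Going backwards in time means dividing by \<open>relax (lam b) T\<close>.
  The whole theorem therefore rests on one estimate, uniform in \<open>lam \<ge> l0\<close>:
  \<open>C1 \<le> lam * relax lam T \<le> C2\<close>. The terminal value determines \<open>u 0\<close>, a terminal value in \<open>D\<close> is
  exactly one for which \<open>u 0\<close> has square summable coefficients, and Parseval's identity turns the
  estimate into the comparison of \<open>norm (u 0)\<close> and \<open>norm (A (u T))\<close>.

  Apart from existence and smoothness, everything about \<open>relax lam\<close> follows from a maximum principle. If \<open>h\<close> attains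
  at \<open>t\<close> its maximum over \<open>{0..t}\<close>, integration by parts shows that the Caputo derivative at \<open>t\<close> is at
  least \<open>t powr - r * (h t - h 0) / Gamma (1 - r)\<close> (\<open>caputo_deriv_at_maximum\<close>). This gives uniqueness,
  \<open>0 < relax lam \<le> 1\<close>, and the lower bound for \<open>lam * relax lam T\<close> once \<open>relax lam\<close> is known to decrease.
  That it decreases comes from comparing a minimum with a later maximum (\<open>caputo_deriv_min_to_max\<close>),
  which uses that the kernels \<open>t powr - r\<close> are convex. Comparing \<open>relax lam (c * t)\<close> with
  \<open>relax lam t\<close> for \<open>c > 1\<close> shows that the derivative of \<open>relax lam\<close> at \<open>t\<close> is at least \<open>- 1 / t\<close>, for
  all \<open>lam\<close> at once (\<open>relaxation_derivative_bound\<close>), and inserting this into the equation gives the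
  upper bound for \<open>lam * relax lam T\<close>.
  The same uniform bounds permit differentiating \<open>\<Sum>b. relax (lam b) t * (x \<bullet> b) * b\<close> term by term
  and computing its Caputo derivatives.

  Existence of \<open>relax lam\<close> is obtained from an explicit series of fractional powers, the Neumann
  series of the Volterra equation that results from integrating the relaxation equation to the
  order \<open>\<rho> 1\<close>, the largest one.
\<close>

section \<open>Orthonormal bases and diagonal operators\<close>

text \<open>
  Dominated convergence for unordered sums: outside a finite set the dominating sum is small, and
  on the finite set the terms tend to zero one by one.
\<close>

lemma infsum_dominated_tendsto_zero:
  fixes f :: "'s \<Rightarrow> 'i \<Rightarrow> real"
  assumes g: "g summable_on B"
    and dom: "eventually (\<lambda>s. \<forall>b\<in>B. 0 \<le> f s b \<and> f s b \<le> g b) F"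
    and lim: "\<And>b. b \<in> B \<Longrightarrow> ((\<lambda>s. f s b) \<longlongrightarrow> 0) F"
  shows "((\<lambda>s. infsum (f s) B) \<longlongrightarrow> 0) F"
proof (rule tendstoI)
  fix e :: real assume e: "e > 0"
  obtain X where X: "finite X" "X \<subseteq> B" "dist (sum g X) (infsum g B) \<le> e/2"
    using infsum_finite_approximation[OF g, of "e/2"] e by auto
  have "((\<lambda>s. \<Sum>b\<in>X. f s b) \<longlongrightarrow> (\<Sum>b\<in>X. 0)) F"
    using X lim by (intro tendsto_sum) auto
  then have "eventually (\<lambda>s. (\<Sum>b\<in>X. f s b) < e/2) F"
    using e order_tendstoD(2)[of _ 0 F "e/2"] by simp
  with dom show "eventually (\<lambda>s. dist (infsum (f s) B) 0 < e) F"
  proof eventually_elim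
    case (elim s)
    have fs: "f s summable_on B"
      by (rule summable_on_comparison_test[OF g]) (use elim in auto)
    have gD: "g summable_on (B - X)" and fD: "f s summable_on (B - X)"
      using g fs by (auto intro: summable_on_subset)
    have split: "infsum h B = sum h X + infsum h (B - X)" if "h summable_on B" for h :: "'i \<Rightarrow> real"
    proof -
      have "infsum h (X \<union> (B - X)) = infsum h X + infsum h (B - X)"
        using that X(1) by (intro infsum_Un_disjoint) (auto intro: summable_on_subset)
      with X show ?thesis by (simp add: Un_absorb1)
    qed
    have "infsum (f s) (B - X) \<le> infsum g (B - X)"
      by (rule infsum_mono[OF fD gD]) (use elim in auto)
    then have "infsum (f s) B < e"
      using split[OF g] split[OF fs] X(3) elim(2) by (auto simp: dist_real_def abs_le_iff)
    moreover have "infsum (f s) B \<ge> 0" by (rule infsum_nonneg) (use elim in auto)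
    ultimately show ?case by simp
  qed
qed


locale orthonormal_set =
  fixes B :: "'h::{real_inner,complete_space} set"
  assumes unit: "b \<in> B \<Longrightarrow> norm b = 1"
    and orth: "pairwise orthogonal B"
begin

lemma inner_basis: "b \<in> B \<Longrightarrow> c \<in> B \<Longrightarrow> b \<bullet> c = (if b = c then 1 else 0)"
  using unit orth by (auto simp: pairwise_def orthogonal_def norm_eq_1)

lemma norm_finite_combination:
  assumes "finite X" "X \<subseteq> B"
  shows "(norm (\<Sum>b\<in>X. a b *\<^sub>R b))\<^sup>2 = (\<Sum>b\<in>X. (a b)\<^sup>2)"
proof -
  have "(norm (\<Sum>b\<in>X. a b *\<^sub>R b))\<^sup>2 = (\<Sum>b\<in>X. (norm (a b *\<^sub>R b))\<^sup>2)"
    using orth assms by (intro norm_sum_Pythagorean)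
      (auto simp: pairwise_def orthogonal_def intro: subsetD)
  also have "\<dots> = (\<Sum>b\<in>X. (a b)\<^sup>2)"
    using assms unit by (intro sum.cong) (auto simp: power_mult_distrib)
  finally show ?thesis .
qed

lemma inner_finite_combination:
  assumes "finite X" "X \<subseteq> B" "c \<in> B"
  shows "(\<Sum>b\<in>X. a b *\<^sub>R b) \<bullet> c = (if c \<in> X then a c else 0)"
proof -
  have "(\<Sum>b\<in>X. a b *\<^sub>R b) \<bullet> c = (\<Sum>b\<in>X. if b = c then a c else 0)"
    unfolding inner_sum_left using assms inner_basis by (intro sum.cong) auto
  also have "\<dots> = (if c \<in> X then a c else 0)" using assms by simp
  finally show ?thesis .
qed

lemma bessel:
  assumes "finite X" "X \<subseteq> B"
  shows "(\<Sum>b\<in>X. (x \<bullet> b)\<^sup>2) \<le> (norm x)\<^sup>2"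
proof -
  let ?y = "\<Sum>b\<in>X. (x \<bullet> b) *\<^sub>R b"
  have "x \<bullet> ?y = (\<Sum>b\<in>X. (x \<bullet> b)\<^sup>2)"
    by (simp add: inner_sum_right power2_eq_square)
  moreover have "?y \<bullet> ?y = (\<Sum>b\<in>X. (x \<bullet> b)\<^sup>2)"
    using norm_finite_combination[OF assms, of "\<lambda>b. x \<bullet> b"] by (simp add: power2_norm_eq_inner)
  moreover have "(x - ?y) \<bullet> (x - ?y) \<ge> 0" by simp
  ultimately show ?thesis
    by (simp add: power2_norm_eq_inner inner_diff_left inner_diff_right inner_commute)
qed

lemma summable_coefficients: "(\<lambda>b. (x \<bullet> b)\<^sup>2) summable_on B"
  by (rule nonneg_bounded_partial_sums_imp_summable_on[where C = "(norm x)\<^sup>2"])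
     (auto intro!: eventually_finite_subsets_at_top_weakI bessel)

text \<open>
  Choosing finite sets whose partial sums of squares approach the total gives a Cauchy sequence of
  finite combinations, by Pythagoras. A sequence is enough, also for an uncountable index set: a
  basis vector that is never chosen has a coefficient whose square is below every remainder, so it
  is zero.
\<close>

lemma riesz_fischer:
  assumes a: "(\<lambda>b. (a b)\<^sup>2) summable_on B"
  obtains y where "\<And>b. b \<in> B \<Longrightarrow> y \<bullet> b = a b" "(norm y)\<^sup>2 = infsum (\<lambda>b. (a b)\<^sup>2) B"
proof -
  define S where "S = infsum (\<lambda>b. (a b)\<^sup>2) B"
  have "\<exists>X. finite X \<and> X \<subseteq> B \<and> dist (\<Sum>b\<in>X. (a b)\<^sup>2) S \<le> inverse (real (Suc n))" for n
    unfolding S_def using a by (intro infsum_finite_approximation) auto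
  then obtain X where fin: "\<And>n. finite (X n)" and sub: "\<And>n. X n \<subseteq> B"
    and close: "\<And>n. dist (\<Sum>b\<in>X n. (a b)\<^sup>2) S \<le> inverse (real (Suc n))"
    by metis
  have le_S: "(\<Sum>b\<in>G. (a b)\<^sup>2) \<le> S" if "finite G" "G \<subseteq> B" for G
    unfolding S_def using that a by (intro finite_sum_le_infsum) auto
  have tail: "(\<Sum>b\<in>G - X n. (a b)\<^sup>2) \<le> inverse (real (Suc n))" if "finite G" "G \<subseteq> B" for G n
  proof -
    have "(\<Sum>b\<in>G \<union> X n. (a b)\<^sup>2) = (\<Sum>b\<in>G - X n. (a b)\<^sup>2) + (\<Sum>b\<in>X n. (a b)\<^sup>2)"
      using that fin by (subst sum.union_disjoint[symmetric]) auto
    moreover have "(\<Sum>b\<in>G \<union> X n. (a b)\<^sup>2) \<le> S" using that fin sub by (intro le_S) auto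
    ultimately show ?thesis using close[of n] by (auto simp: dist_real_def abs_le_iff)
  qed
  define y where "y n = (\<Sum>b\<in>X n. a b *\<^sub>R b)" for n
  have dist_y: "dist (\<Sum>b\<in>G. a b *\<^sub>R b) (y n) \<le> sqrt (inverse (real (Suc n)))"
    if "finite G" "X n \<subseteq> G" "G \<subseteq> B" for G n
  proof -
    have "(\<Sum>b\<in>G. a b *\<^sub>R b) - y n = (\<Sum>b\<in>G - X n. a b *\<^sub>R b)"
      unfolding y_def using that by (simp add: sum_diff fin)
    then have "(norm ((\<Sum>b\<in>G. a b *\<^sub>R b) - y n))\<^sup>2 \<le> inverse (real (Suc n))"
      using norm_finite_combination[of "G - X n" a] tail[of G n] that by (simp add: subset_iff)
    then show ?thesis by (auto simp: dist_norm intro: real_le_rsqrt)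
  qed
  have dist_yy: "dist (y m) (y n) \<le> sqrt (inverse (real (Suc m))) + sqrt (inverse (real (Suc n)))" for m n
    using dist_y[of "X m \<union> X n" m] dist_y[of "X m \<union> X n" n] fin sub
      dist_triangle3[of "y m" "y n" "\<Sum>b\<in>X m \<union> X n. a b *\<^sub>R b"] by fastforce
  have sq0: "(\<lambda>n. sqrt (inverse (real (Suc n)))) \<longlonglongrightarrow> 0"
    using tendsto_real_sqrt[OF LIMSEQ_inverse_real_of_nat] by simp
  have "Cauchy y"
  proof (rule metric_CauchyI)
    fix e :: real assume "e > 0"
    then obtain N where N: "\<And>n. n \<ge> N \<Longrightarrow> sqrt (inverse (real (Suc n))) < e/2"
      using order_tendstoD(2)[OF sq0, of "e/2"] unfolding eventually_sequentially by auto
    have "dist (y m) (y n) < e" if "m \<ge> N" "n \<ge> N" for m n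
      using dist_yy[of m n] N[OF that(1)] N[OF that(2)] by linarith
    then show "\<exists>N. \<forall>m\<ge>N. \<forall>n\<ge>N. dist (y m) (y n) < e" by blast
  qed
  then obtain z where z: "y \<longlonglongrightarrow> z" using Cauchy_convergent unfolding convergent_def by blast
  have coef: "z \<bullet> b = a b" if b: "b \<in> B" for b
  proof -
    have "\<bar>y n \<bullet> b - a b\<bar> \<le> sqrt (inverse (real (Suc n)))" for n
    proof (cases "b \<in> X n")
      case True
      then show ?thesis unfolding y_def using inner_finite_combination[OF fin sub b] by simp
    next
      case False
      then have "(a b)\<^sup>2 \<le> inverse (real (Suc n))" using tail[of "{b}" n] b by (simp add: insert_Diff_if)
      then have "\<bar>a b\<bar> \<le> sqrt (inverse (real (Suc n)))"
        by (metis abs_ge_zero power2_abs real_le_rsqrt)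
      then show ?thesis using False unfolding y_def using inner_finite_combination[OF fin sub b] by simp
    qed
    then have "(\<lambda>n. y n \<bullet> b) \<longlonglongrightarrow> a b"
      by (intro LIM_zero_cancel[OF Lim_null_comparison[OF _ sq0]]) auto
    moreover have "(\<lambda>n. y n \<bullet> b) \<longlonglongrightarrow> z \<bullet> b" by (intro tendsto_intros z)
    ultimately show ?thesis using LIMSEQ_unique by blast
  qed
  have "(\<lambda>n. \<Sum>b\<in>X n. (a b)\<^sup>2) \<longlonglongrightarrow> S"
    using close by (intro LIM_zero_cancel[OF Lim_null_comparison[OF _ LIMSEQ_inverse_real_of_nat]])
      (auto simp: dist_real_def)
  moreover have "(\<Sum>b\<in>X n. (a b)\<^sup>2) = (norm (y n))\<^sup>2" for n
    unfolding y_def by (simp add: norm_finite_combination fin sub)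
  ultimately have "(\<lambda>n. (norm (y n))\<^sup>2) \<longlonglongrightarrow> S" by simp
  moreover have "(\<lambda>n. (norm (y n))\<^sup>2) \<longlonglongrightarrow> (norm z)\<^sup>2" by (intro tendsto_intros z)
  ultimately have "(norm z)\<^sup>2 = S" using LIMSEQ_unique by blast
  with coef that show thesis unfolding S_def by blast
qed

end

locale orthonormal_basis = orthonormal_set +
  assumes total: "(\<And>b. b \<in> B \<Longrightarrow> x \<bullet> b = 0) \<Longrightarrow> x = 0"
begin

lemma eq_if_coefficients_eq:
  assumes "\<And>b. b \<in> B \<Longrightarrow> x \<bullet> b = y \<bullet> b" shows "x = y"
  using total[of "x - y"] assms by (simp add: inner_diff_left)

lemma parseval: "(norm x)\<^sup>2 = infsum (\<lambda>b. (x \<bullet> b)\<^sup>2) B"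
  by (metis (no_types, lifting) riesz_fischer[OF summable_coefficients[of x]] eq_if_coefficients_eq)

text \<open>
  The operator that multiplies the coefficient at \<open>b\<close> by \<open>m b\<close>. It has this property when \<open>m\<close> is
  bounded on the basis (\<open>diag_inner\<close>).
\<close>

definition diag :: "('a \<Rightarrow> real) \<Rightarrow> 'a \<Rightarrow> 'a" where
  "diag m x = (SOME y. \<forall>b\<in>B. y \<bullet> b = m b * (x \<bullet> b))"

lemma diag_inner:
  assumes m: "\<And>b. b \<in> B \<Longrightarrow> \<bar>m b\<bar> \<le> C" and b: "b \<in> B"
  shows "diag m x \<bullet> b = m b * (x \<bullet> b)"
proof -
  have "(\<lambda>b. (m b * (x \<bullet> b))\<^sup>2) summable_on B"
  proof (rule summable_on_comparison_test)
    show "(\<lambda>b. C\<^sup>2 * (x \<bullet> b)\<^sup>2) summable_on B"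
      by (intro summable_on_cmult_right summable_coefficients)
    fix b assume "b \<in> B"
    then have "(m b)\<^sup>2 \<le> C\<^sup>2" using m[of b] by (metis abs_ge_zero power2_abs power_mono)
    then show "(m b * (x \<bullet> b))\<^sup>2 \<le> C\<^sup>2 * (x \<bullet> b)\<^sup>2"
      by (simp add: power_mult_distrib mult_right_mono)
  qed auto
  from riesz_fischer[OF this] obtain y where "\<forall>b\<in>B. y \<bullet> b = m b * (x \<bullet> b)" by metis
  then have "\<forall>b\<in>B. diag m x \<bullet> b = m b * (x \<bullet> b)" unfolding diag_def by (rule someI)
  with b show ?thesis by blast
qed

text \<open>
  Strong convergence of multiplication operators needs only a uniform bound and convergence of
  each multiplier. Continuity and differentiability of diagonal evolutions both reduce to it.
\<close>

lemma tendsto_diag: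
  assumes bound: "eventually (\<lambda>s. \<forall>b\<in>B. \<bar>m s b\<bar> \<le> C) F"
    and lim: "\<And>b. b \<in> B \<Longrightarrow> ((\<lambda>s. m s b) \<longlongrightarrow> m0 b) F"
  shows "((\<lambda>s. diag (m s) x) \<longlongrightarrow> diag m0 x) F"
proof (cases "F = bot")
  case False
  have m0: "\<bar>m0 b\<bar> \<le> C" if "b \<in> B" for b
    by (rule tendsto_upperbound[OF tendsto_rabs[OF lim[OF that]] _ False])
       (use bound that in \<open>auto elim: eventually_mono\<close>)
  have "((\<lambda>s. infsum (\<lambda>b. ((m s b - m0 b) * (x \<bullet> b))\<^sup>2) B) \<longlongrightarrow> 0) F"
  proof (rule infsum_dominated_tendsto_zero)
    show "(\<lambda>b. (2 * C)\<^sup>2 * (x \<bullet> b)\<^sup>2) summable_on B"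
      by (intro summable_on_cmult_right summable_coefficients)
    show "\<forall>\<^sub>F s in F. \<forall>b\<in>B. 0 \<le> ((m s b - m0 b) * (x \<bullet> b))\<^sup>2 \<and>
        ((m s b - m0 b) * (x \<bullet> b))\<^sup>2 \<le> (2 * C)\<^sup>2 * (x \<bullet> b)\<^sup>2"
      using bound
    proof eventually_elim
      case (elim s)
      have "(m s b - m0 b)\<^sup>2 \<le> (2 * C)\<^sup>2" if "b \<in> B" for b
        using elim that m0[OF that] by (intro power2_le_iff_abs_le[THEN iffD2]) (auto simp: abs_le_iff)
      then show ?case by (auto simp: power_mult_distrib intro!: mult_right_mono)
    qed
    fix b assume "b \<in> B"
    then have "((\<lambda>s. ((m s b - m0 b) * (x \<bullet> b))\<^sup>2) \<longlongrightarrow> ((m0 b - m0 b) * (x \<bullet> b))\<^sup>2) F"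
      by (intro tendsto_intros lim)
    then show "((\<lambda>s. ((m s b - m0 b) * (x \<bullet> b))\<^sup>2) \<longlongrightarrow> 0) F" by simp
  qed
  moreover have "\<forall>\<^sub>F s in F. infsum (\<lambda>b. ((m s b - m0 b) * (x \<bullet> b))\<^sup>2) B = (norm (diag (m s) x - diag m0 x))\<^sup>2"
    using bound
  proof eventually_elim
    case (elim s)
    have "(diag (m s) x - diag m0 x) \<bullet> b = (m s b - m0 b) * (x \<bullet> b)" if "b \<in> B" for b
      using diag_inner[of "m s" C b x] diag_inner[of m0 C b x] elim m0 that
      by (simp add: inner_diff_left left_diff_distrib)
    then show ?case unfolding parseval by (intro infsum_cong) simp
  qed
  ultimately have "((\<lambda>s. (norm (diag (m s) x - diag m0 x))\<^sup>2) \<longlongrightarrow> 0) F"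
    using tendsto_cong by fastforce
  from tendsto_real_sqrt[OF this] show ?thesis
    by (simp add: tendsto_norm_zero_iff LIM_zero_iff)
qed simp

lemma continuous_on_diag:
  assumes bound: "\<And>s b. s \<in> S \<Longrightarrow> b \<in> B \<Longrightarrow> \<bar>m s b\<bar> \<le> C"
    and cont: "\<And>b. b \<in> B \<Longrightarrow> continuous_on S (\<lambda>s. m s b)"
  shows "continuous_on S (\<lambda>s. diag (m s) x)"
  unfolding continuous_on
  by (intro ballI tendsto_diag[where C = C])
     (use assms in \<open>auto simp: continuous_on eventually_at_filter\<close>)

text \<open>
  The difference quotient of a diagonal family is the diagonal family of the difference quotients.
  By the mean value theorem these are bounded by \<open>C'\<close>, so \<open>tendsto_diag\<close> applies.
\<close>

lemma diag_has_vector_derivative: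
  assumes S: "open S" "convex S" "t \<in> S"
    and bound: "\<And>s b. s \<in> S \<Longrightarrow> b \<in> B \<Longrightarrow> \<bar>m s b\<bar> \<le> C"
    and bound': "\<And>s b. s \<in> S \<Longrightarrow> b \<in> B \<Longrightarrow> \<bar>m' s b\<bar> \<le> C'"
    and deriv: "\<And>s b. s \<in> S \<Longrightarrow> b \<in> B \<Longrightarrow> ((\<lambda>s. m s b) has_real_derivative m' s b) (at s)"
  shows "((\<lambda>s. diag (m s) x) has_vector_derivative diag (m' t) x) (at t)"
proof -
  let ?Q = "\<lambda>s b. (m s b - m t b) / (s - t)"
  have ev: "\<forall>\<^sub>F s in at t. s \<in> S \<and> s \<noteq> t"
    using S by (simp add: eventually_conj eventually_at_in_open' eventually_neq_at_within)
  have Qb: "\<bar>?Q s b\<bar> \<le> C'" if "s \<in> S" "s \<noteq> t" "b \<in> B" for s b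
  proof -
    have "norm (m s b - m t b) \<le> C' * norm (s - t)"
      by (rule field_differentiable_bound[OF S(2), where f' = "\<lambda>s. m' s b"])
         (use that S deriv bound' in \<open>auto intro: has_field_derivative_at_within\<close>)
    then show ?thesis using that by (simp add: divide_le_eq)
  qed
  have "((\<lambda>s. diag (?Q s) x) \<longlongrightarrow> diag (m' t) x) (at t)"
  proof (rule tendsto_diag)
    show "\<forall>\<^sub>F s in at t. \<forall>b\<in>B. \<bar>?Q s b\<bar> \<le> C'"
      using ev by (rule eventually_mono) (use Qb in blast)
    show "((\<lambda>s. ?Q s b) \<longlongrightarrow> m' t b) (at t)" if "b \<in> B" for b
      using deriv[OF S(3) that] by (simp add: has_field_derivative_iff)
  qed
  moreover have "\<forall>\<^sub>F s in at t. diag (?Q s) x = (diag (m s) x - diag (m t) x) /\<^sub>R (s - t)"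
    using ev
  proof eventually_elim
    case (elim s)
    show ?case
    proof (rule eq_if_coefficients_eq)
      fix b assume b: "b \<in> B"
      have "diag (?Q s) x \<bullet> b = ?Q s b * (x \<bullet> b)"
        using elim Qb by (intro diag_inner[OF _ b, of _ C']) blast
      moreover have "diag (m r) x \<bullet> b = m r b * (x \<bullet> b)" if "r \<in> S" for r
        using bound[OF that] b by (intro diag_inner)
      ultimately show "diag (?Q s) x \<bullet> b = ((diag (m s) x - diag (m t) x) /\<^sub>R (s - t)) \<bullet> b"
        using elim S(3) by (simp add: inner_diff_left divide_inverse left_diff_distrib right_diff_distrib mult_ac)
    qed
  qed
  ultimately have "((\<lambda>s. (diag (m s) x - diag (m t) x) /\<^sub>R (s - t)) \<longlongrightarrow> diag (m' t) x) (at t)"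
    using tendsto_cong by fastforce
  then have "((\<lambda>s. (diag (m s) x - diag (m t) x) /\<^sub>R (s - t) - diag (m' t) x) \<longlongrightarrow> 0) (at t)"
    by (rule LIM_zero)
  then have "((\<lambda>s. norm ((diag (m s) x - diag (m t) x) /\<^sub>R (s - t) - diag (m' t) x)) \<longlongrightarrow> 0) (at t)"
    by (rule tendsto_norm_zero)
  moreover have "\<forall>\<^sub>F s in at t. norm ((diag (m s) x - diag (m t) x) /\<^sub>R (s - t) - diag (m' t) x) =
      norm (diag (m s) x - diag (m t) x - (s - t) *\<^sub>R diag (m' t) x) / norm (s - t)"
    using ev
  proof eventually_elim
    case (elim s)
    have "(diag (m s) x - diag (m t) x) /\<^sub>R (s - t) - diag (m' t) x =
       (diag (m s) x - diag (m t) x - (s - t) *\<^sub>R diag (m' t) x) /\<^sub>R (s - t)"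
      using elim by (simp add: scaleR_diff_right)
    then show ?case by (simp add: divide_inverse mult.commute)
  qed
  ultimately have "((\<lambda>s. norm (diag (m s) x - diag (m t) x - (s - t) *\<^sub>R diag (m' t) x) / norm (s - t)) \<longlongrightarrow> 0) (at t)"
    using tendsto_cong by fastforce
  then show ?thesis
    unfolding has_vector_derivative_def has_derivative_iff_norm by (simp add: bounded_linear_scaleR_left)
qed

end

section \<open>Compact positive operators have an eigenbasis\<close>

locale compact_positive_operator =
  fixes K :: "'h::{real_inner,complete_space} \<Rightarrow> 'h"
  assumes bl: "bounded_linear K"
    and compact_image: "bounded S \<Longrightarrow> compact (closure (K ` S))"
    and symmetric: "K x \<bullet> y = x \<bullet> K y"
    and positive: "x \<noteq> 0 \<Longrightarrow> K x \<bullet> x > 0"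
begin

interpretation K: bounded_linear K by (rule bl)

text \<open>
  Let \<open>N\<close> be the norm of \<open>K\<close> restricted to \<open>W\<close>, approached by \<open>norm (K (w n))\<close> for unit vectors \<open>w n\<close>.
  Expanding the square shows that \<open>K (K (w n)) - N\<^sup>2 *\<^sub>R w n\<close> tends to zero, and compactness turns this
  into a unit vector \<open>u\<close> of \<open>W\<close> with \<open>K (K u) = N\<^sup>2 *\<^sub>R u\<close>. Then \<open>K u + N *\<^sub>R u\<close> is an eigenvector, and
  it is nonzero by positivity.
\<close>

lemma eigenvector_in_invariant_subspace:
  assumes W: "subspace W" "closed W" "\<And>x. x \<in> W \<Longrightarrow> K x \<in> W" and x: "x \<in> W" "x \<noteq> 0"
  obtains z \<mu> where "z \<in> W" "norm z = 1" "K z = \<mu> *\<^sub>R z"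
proof -
  define U where "U = {norm (K x) | x. x \<in> W \<and> norm x = 1}"
  define N where "N = Sup U"
  have bdd: "bdd_above U"
  proof -
    obtain C where "\<And>x. norm (K x) \<le> norm x * C" using K.bounded by blast
    then have "norm (K x) \<le> C" if "norm x = 1" for x using that by (metis mult_1)
    then have "r \<le> C" if "r \<in> U" for r using that unfolding U_def by blast
    then show ?thesis by (rule bdd_aboveI)
  qed
  have N_ge: "norm (K w) \<le> N" if "w \<in> W" "norm w = 1" for w
    unfolding N_def using that by (intro cSup_upper bdd) (auto simp: U_def)
  have N_bound: "norm (K w) \<le> N * norm w" if "w \<in> W" for w
  proof (cases "w = 0")
    case False
    have "norm (K (w /\<^sub>R norm w)) \<le> N"
      using that False W(1) by (intro N_ge) (auto intro: subspace_scale)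
    then show ?thesis using False by (simp add: K.scaleR inverse_eq_divide pos_divide_le_eq)
  qed (simp add: K.zero)
  have U_ne: "U \<noteq> {}"
  proof -
    have "norm (K (x /\<^sub>R norm x)) \<in> U"
      unfolding U_def mem_Collect_eq
      using x W(1) by (intro exI[of _ "x /\<^sub>R norm x"]) (auto intro: subspace_scale)
    then show ?thesis by blast
  qed
  have "K x \<noteq> 0" using positive[OF x(2)] by auto
  then have "N * norm x > 0" using N_bound[OF x(1)] by (smt (verit) zero_less_norm_iff)
  then have N_pos: "N > 0" by (simp add: zero_less_mult_iff)
  have "\<exists>w. w \<in> W \<and> norm w = 1 \<and> norm (K w) > N - inverse (real (Suc n))" for n
  proof -
    have "\<exists>r\<in>U. N - inverse (real (Suc n)) < r"
      unfolding N_def by (subst less_cSup_iff[symmetric]) (auto simp: U_ne bdd)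
    then show ?thesis unfolding U_def by blast
  qed
  then obtain w where w: "\<And>n. w n \<in> W" "\<And>n. norm (w n) = 1"
    and wN: "\<And>n. norm (K (w n)) > N - inverse (real (Suc n))" by metis
  have Kw_lim: "(\<lambda>n. norm (K (w n))) \<longlonglongrightarrow> N"
  proof (rule tendsto_sandwich[OF _ _ _ tendsto_const])
    show "(\<lambda>n. N - inverse (real (Suc n))) \<longlonglongrightarrow> N"
      using tendsto_diff[OF tendsto_const LIMSEQ_inverse_real_of_nat, of N] by simp
  qed (use wN w N_ge in \<open>auto intro!: always_eventually less_imp_le\<close>)
  have "compact (closure (K ` {v. norm v \<le> 1}))"
    by (intro compact_image) (auto simp: bounded_iff)
  moreover have "\<forall>n. K (w n) \<in> closure (K ` {v. norm v \<le> 1})"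
    using w(2) by (intro allI closure_subset[THEN subsetD] imageI) simp
  ultimately have "\<exists>y\<in>closure (K ` {v. norm v \<le> 1}). \<exists>r. strict_mono r \<and> ((\<lambda>n. K (w n)) \<circ> r) \<longlonglongrightarrow> y"
    unfolding compact_def by simp
  then obtain y r where r: "strict_mono (r :: nat \<Rightarrow> nat)" and y: "((\<lambda>n. K (w n)) \<circ> r) \<longlonglongrightarrow> y"
    by blast
  define v where "v n = w (r n)" for n
  have v: "v n \<in> W" "norm (v n) = 1" for n using w by (auto simp: v_def)
  have Kv: "(\<lambda>n. K (v n)) \<longlonglongrightarrow> y" using y by (simp add: v_def o_def)
  have Kv_norm: "(\<lambda>n. norm (K (v n))) \<longlonglongrightarrow> N"
    using LIMSEQ_subseq_LIMSEQ[OF Kw_lim r] by (simp add: v_def o_def)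
  have est: "(norm (K (K (v n)) - N\<^sup>2 *\<^sub>R v n))\<^sup>2 \<le> N^4 - N\<^sup>2 * (norm (K (v n)))\<^sup>2" for n
  proof -
    let ?k = "norm (K (v n))"
    have KK: "norm (K (K (v n))) \<le> N * ?k" using N_bound W(3) v(1) by blast
    have k: "?k \<le> N" using N_ge v by blast
    have "(norm (K (K (v n))))\<^sup>2 \<le> (N * ?k)\<^sup>2" using KK by (intro power_mono) auto
    moreover have "K (K (v n)) \<bullet> v n = ?k\<^sup>2" by (simp add: symmetric power2_norm_eq_inner)
    moreover have "v n \<bullet> v n = 1" using v(2)[of n] by (simp add: norm_eq_1)
    moreover have "(norm (K (K (v n)) - N\<^sup>2 *\<^sub>R v n))\<^sup>2 =
        (norm (K (K (v n))))\<^sup>2 - 2 * N\<^sup>2 * (K (K (v n)) \<bullet> v n) + N\<^sup>2 * N\<^sup>2 * (v n \<bullet> v n)"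
      unfolding power2_norm_eq_inner
      by (simp add: inner_diff_left inner_diff_right inner_commute)
    ultimately show ?thesis
      by (simp add: power_mult_distrib power4_eq_xxxx power2_eq_square[of N] mult.assoc)
  qed
  have "(\<lambda>n. N^4 - N\<^sup>2 * (norm (K (v n)))\<^sup>2) \<longlonglongrightarrow> N^4 - N\<^sup>2 * N\<^sup>2"
    by (intro tendsto_intros Kv_norm)
  then have lim0: "(\<lambda>n. N^4 - N\<^sup>2 * (norm (K (v n)))\<^sup>2) \<longlonglongrightarrow> 0"
    by (simp add: power2_eq_square power4_eq_xxxx mult.assoc)
  have "(\<lambda>n. (norm (K (K (v n)) - N\<^sup>2 *\<^sub>R v n))\<^sup>2) \<longlonglongrightarrow> 0"
    by (rule Lim_null_comparison[OF _ lim0]) (use est in auto)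
  from tendsto_real_sqrt[OF this] have d0: "(\<lambda>n. K (K (v n)) - N\<^sup>2 *\<^sub>R v n) \<longlonglongrightarrow> 0"
    by (simp add: tendsto_norm_zero_iff)
  have "(\<lambda>n. K (K (v n)) - (K (K (v n)) - N\<^sup>2 *\<^sub>R v n)) \<longlonglongrightarrow> K y - 0"
    by (intro tendsto_diff d0 K.tendsto Kv)
  then have "(\<lambda>n. inverse (N\<^sup>2) *\<^sub>R (N\<^sup>2 *\<^sub>R v n)) \<longlonglongrightarrow> inverse (N\<^sup>2) *\<^sub>R K y"
    by (intro tendsto_intros) simp
  then have v_lim: "v \<longlonglongrightarrow> inverse (N\<^sup>2) *\<^sub>R K y" using N_pos by simp
  define u where "u = inverse (N\<^sup>2) *\<^sub>R K y"
  note v_lim = v_lim[folded u_def]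
  have uW: "u \<in> W" using closed_sequentially[OF W(2)] v(1) v_lim by blast
  have "(\<lambda>n. norm (v n)) \<longlonglongrightarrow> norm u" by (intro tendsto_intros v_lim)
  with v(2) have u1: "norm u = 1" by (simp add: LIMSEQ_const_iff)
  have "K u = y" using K.tendsto[OF v_lim] Kv LIMSEQ_unique by blast
  then have KKu: "K (K u) = N\<^sup>2 *\<^sub>R u" using N_pos by (simp add: u_def)
  \<comment> \<open>This is the factor K + N of K^2 - N^2, applied to u.\<close>
  define z where "z = K u + N *\<^sub>R u"
  have zW: "z \<in> W" unfolding z_def using W uW by (intro subspace_add subspace_scale) auto
  have Kz: "K z = N *\<^sub>R z"
    by (simp add: z_def K.add K.scaleR KKu scaleR_add_right power2_eq_square add.commute)
  have "u \<noteq> 0" using u1 by auto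
  then have "z \<bullet> u > 0"
    using positive[of u] u1 N_pos by (auto simp: z_def inner_add_left norm_eq_1 intro!: add_pos_pos)
  then have "z \<noteq> 0" by auto
  show thesis
  proof (rule that)
    show "z /\<^sub>R norm z \<in> W" using zW W(1) by (rule subspace_scale[rotated])
    show "norm (z /\<^sub>R norm z) = 1" using \<open>z \<noteq> 0\<close> by simp
    show "K (z /\<^sub>R norm z) = N *\<^sub>R (z /\<^sub>R norm z)" by (simp add: K.scaleR Kz)
  qed
qed

text \<open>
  A maximal orthonormal set of eigenvectors is total. Otherwise its orthogonal complement is a
  nonzero closed subspace, invariant because \<open>K\<close> is symmetric, and it contains another eigenvector.
\<close>

theorem eigenbasis:
  obtains B \<mu> where "orthonormal_basis B" "\<And>b. b \<in> B \<Longrightarrow> K b = \<mu> b *\<^sub>R b"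
proof -
  define A where "A = {B. (\<forall>b\<in>B. norm b = 1 \<and> (\<exists>\<mu>. K b = \<mu> *\<^sub>R b)) \<and> pairwise orthogonal B}"
  have "\<exists>B\<in>A. \<forall>X\<in>A. B \<subseteq> X \<longrightarrow> X = B"
  proof (rule subset_Zorn')
    fix C assume C: "subset.chain A C"
    have "pairwise orthogonal (\<Union>C)"
    proof (rule pairwiseI)
      fix x y assume "x \<in> \<Union>C" "y \<in> \<Union>C" and ne: "x \<noteq> y"
      then obtain X Y where "X \<in> C" "x \<in> X" "Y \<in> C" "y \<in> Y" by blast
      moreover from this have "X \<subseteq> Y \<or> Y \<subseteq> X" using C by (auto simp: subset_chain_def)
      ultimately obtain Z where "Z \<in> C" "x \<in> Z" "y \<in> Z" by blast
      moreover from this have "pairwise orthogonal Z" using C by (auto simp: subset_chain_def A_def)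
      ultimately show "orthogonal x y" using ne by (auto simp: pairwise_def)
    qed
    then show "\<Union>C \<in> A" using C by (auto simp: A_def subset_chain_def)
  qed
  then obtain B where B: "B \<in> A" and max: "\<And>X. X \<in> A \<Longrightarrow> B \<subseteq> X \<Longrightarrow> X = B" by blast
  from B obtain \<mu> where unit: "\<And>b. b \<in> B \<Longrightarrow> norm b = 1" and eig: "\<And>b. b \<in> B \<Longrightarrow> K b = \<mu> b *\<^sub>R b"
    and orth: "pairwise orthogonal B" unfolding A_def by auto metis
  have "orthonormal_basis B"
  proof
    fix x assume "\<And>b. b \<in> B \<Longrightarrow> x \<bullet> b = 0"
    define W where "W = {x. \<forall>b\<in>B. x \<bullet> b = 0}"
    have "x \<in> W" using \<open>\<And>b. b \<in> B \<Longrightarrow> x \<bullet> b = 0\<close> by (simp add: W_def)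
    show "x = 0"
    proof (rule ccontr)
      assume "x \<noteq> 0"
      have "subspace W" by (auto simp: W_def subspace_def inner_add_left)
      moreover have "closed W"
      proof -
        have "W = (\<Inter>b\<in>B. {x. x \<bullet> b = 0})" by (auto simp: W_def)
        moreover have "closed {x. x \<bullet> b = 0}" for b :: 'h
          by (intro closed_Collect_eq continuous_intros)
        ultimately show ?thesis by auto
      qed
      moreover have "K w \<in> W" if "w \<in> W" for w
        using that by (auto simp: W_def symmetric eig)
      ultimately obtain z \<nu> where z: "z \<in> W" "norm z = 1" "K z = \<nu> *\<^sub>R z"
        using eigenvector_in_invariant_subspace \<open>x \<in> W\<close> \<open>x \<noteq> 0\<close> by metis
      have "insert z B \<in> A"
        using B z by (auto simp: A_def W_def pairwise_insert orthogonal_def inner_commute)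
      then have "z \<in> B" using max by blast
      then have "z \<bullet> z = 0" using z(1) by (simp add: W_def)
      with z(2) show False by (simp add: norm_eq_1)
    qed
  qed (use unit orth in auto)
  with eig that show thesis by blast
qed

end

text \<open>
  The spectral description of \<open>A\<close>. The last assumption says that the domain is as large as it can
  be: a vector belongs to it as soon as the coefficients multiplied by the eigenvalues are those of
  some vector.
\<close>

locale operator_eigenbasis = orthonormal_basis B
  for B :: "'h::{real_inner,complete_space} set" +
  fixes D :: "'h set" and A :: "'h \<Rightarrow> 'h" and lam :: "'h \<Rightarrow> real" and l0 :: real
  assumes l0_pos: "l0 > 0"
    and lam_ge: "b \<in> B \<Longrightarrow> l0 \<le> lam b"
    and A_coefficient: "x \<in> D \<Longrightarrow> b \<in> B \<Longrightarrow> A x \<bullet> b = lam b * (x \<bullet> b)"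
    and in_domain: "(\<And>b. b \<in> B \<Longrightarrow> z \<bullet> b = lam b * (y \<bullet> b)) \<Longrightarrow> y \<in> D \<and> A y = z"

text \<open>
  The eigenvectors are those of the inverse \<open>K\<close>. The eigenvalues of \<open>A\<close> are bounded below because \<open>K\<close>
  is bounded, and \<open>K\<close> is bounded because it maps the unit ball into a compact set.
\<close>

theorem operator_eigenbasis_exists:
  fixes D :: "'h::{real_inner, complete_space} set"
  assumes sa: "self_adjoint_operator D A" and pos: "positive_operator D A" and comp: "has_compact_inverse D A"
  obtains B lam l0 where "operator_eigenbasis B D A lam l0"
proof -
  define K where "K = inv_into D A"
  from comp have bij: "bij_betw A D UNIV"
    and cpt: "\<And>S :: 'h set. bounded S \<Longrightarrow> compact (closure (K ` S))"
    unfolding has_compact_inverse_def K_def by blast+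
  have KD: "K x \<in> D" and AK: "A (K x) = x" for x
    using bij unfolding K_def by (auto simp: bij_betw_def inv_into_into f_inv_into_f)
  have KA: "K (A x) = x" if "x \<in> D" for x
    using bij that unfolding K_def by (simp add: bij_betw_inv_into_left)
  from sa have lin: "linear_operator D A" and adj: "adjoint_graph D A = {(x, A x) | x. x \<in> D}"
    unfolding self_adjoint_operator_def by auto
  have sub: "subspace D" and add: "\<And>x y. x \<in> D \<Longrightarrow> y \<in> D \<Longrightarrow> A (x + y) = A x + A y"
    and scale: "\<And>c x. x \<in> D \<Longrightarrow> A (c *\<^sub>R x) = c *\<^sub>R A x"
    using lin unfolding linear_operator_def by auto
  have symA: "A x \<bullet> y = x \<bullet> A y" if "x \<in> D" "y \<in> D" for x y
  proof -
    have "(y, A y) \<in> adjoint_graph D A" unfolding adj using that by auto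
    then show ?thesis using that by (auto simp: adjoint_graph_def)
  qed
  have "K (x + y) = K x + K y" for x y
    using KA[of "K x + K y"] add[OF KD KD, of x y] subspace_add[OF sub KD KD, of x y] by (simp add: AK)
  moreover have "K (c *\<^sub>R x) = c *\<^sub>R K x" for c x
    using KA[of "c *\<^sub>R K x"] scale[OF KD, of c x] subspace_scale[OF sub KD, of c x] by (simp add: AK)
  ultimately have linK: "linear K" by (intro linearI) auto
  have "bounded (K ` {v. norm v \<le> 1})"
    by (rule bounded_subset[OF compact_imp_bounded[OF cpt] closure_subset]) (auto simp: bounded_iff)
  then obtain C where C: "\<And>v. norm v \<le> 1 \<Longrightarrow> norm (K v) \<le> C" by (auto simp: bounded_iff)
  have K_bound: "norm (K x) \<le> norm x * C" for x
  proof (cases "x = 0")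
    case False
    have "norm (K (x /\<^sub>R norm x)) \<le> C" using False by (intro C) auto
    then show ?thesis using False
      by (simp add: linear_cmul[OF linK] inverse_eq_divide pos_divide_le_eq mult.commute)
  qed (simp add: linear_0[OF linK])
  have blK: "bounded_linear K"
    using linK K_bound by (intro bounded_linear.intro bounded_linear_axioms.intro) (auto simp: linear_def)
  interpret compact_positive_operator K
  proof (rule compact_positive_operator.intro)
    show "K x \<bullet> y = x \<bullet> K y" for x y using symA[OF KD KD, of x y] by (simp add: AK)
    show "K x \<bullet> x > 0" if "x \<noteq> 0" for x
    proof -
      have "K x \<noteq> 0" using that AK[of x] AK[of 0] linear_0[OF linK] by metis
      then show ?thesis
        using pos KD[of x] unfolding positive_operator_def by (metis AK inner_commute)
    qed
  qed (fact blK, erule cpt)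
  obtain B \<mu> where B: "orthonormal_basis B" and eig: "\<And>b. b \<in> B \<Longrightarrow> K b = \<mu> b *\<^sub>R b"
    using eigenbasis by blast
  interpret orthonormal_basis B by fact
  have C0: "C \<ge> 0" using C[of 0] norm_ge_zero[of "K 0"] by (simp del: norm_ge_zero)
  have mu_pos: "\<mu> b > 0" if "b \<in> B" for b
  proof -
    have "b \<noteq> 0" using unit[OF that] by auto
    from positive[OF this] show ?thesis using unit[OF that] by (simp add: eig[OF that] norm_eq_1)
  qed
  have mu_le: "\<mu> b \<le> C + 1" if "b \<in> B" for b
    using K_bound[of b] mu_pos[OF that] unit[OF that] by (simp add: eig[OF that])
  have K_coef: "K x \<bullet> b = \<mu> b * (x \<bullet> b)" if "b \<in> B" for x b
    by (simp add: symmetric eig that)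
  have "operator_eigenbasis B D A (\<lambda>b. 1 / \<mu> b) (1 / (C + 1))"
  proof
    show "1 / (C + 1) > 0" using C0 by simp
    show "1 / (C + 1) \<le> 1 / \<mu> b" if "b \<in> B" for b
      using mu_pos[OF that] mu_le[OF that] by (intro divide_left_mono) auto
    show "A x \<bullet> b = 1 / \<mu> b * (x \<bullet> b)" if "x \<in> D" "b \<in> B" for x b
      using K_coef[OF that(2), of "A x"] mu_pos[OF that(2)] by (simp add: KA that)
    show "y \<in> D \<and> A y = z" if "\<And>b. b \<in> B \<Longrightarrow> z \<bullet> b = 1 / \<mu> b * (y \<bullet> b)" for y z
    proof -
      have "y = K z"
      proof (rule eq_if_coefficients_eq)
        fix b assume "b \<in> B"
        then show "y \<bullet> b = K z \<bullet> b" using K_coef that mu_pos[of b] by simp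
      qed
      then show ?thesis using KD AK by auto
    qed
  qed
  then show thesis by (rule that)
qed

section \<open>Caputo derivatives at extrema\<close>

lemma has_integral_le_interior:
  fixes f g :: "real \<Rightarrow> real"
  assumes "(f has_integral i) {a..b}" "(g has_integral j) {a..b}"
    and "\<And>x. a < x \<Longrightarrow> x < b \<Longrightarrow> f x \<le> g x"
  shows "i \<le> j"
proof (rule has_integral_le[where S = "{a<..<b}"])
  show "(f has_integral i) {a<..<b}" "(g has_integral j) {a<..<b}"
    using assms by (simp_all add: has_integral_Icc_iff_Ioo)
qed (use assms(3) in simp)

text \<open>
  Integrating by parts with \<open>f - f t\<close> instead of \<open>f\<close> leaves the integral of \<open>w' * (f t - f)\<close>, which is
  nonnegative, and boundary terms. The weight may be singular at \<open>t\<close>; the assumption on the boundary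
  term lets the upper limit tend to \<open>t\<close>.
\<close>

lemma integral_by_parts_at_maximum:
  fixes f f' w w' :: "real \<Rightarrow> real"
  assumes "a < t" and cont: "continuous_on {a..t} f"
    and f': "\<And>s. a < s \<Longrightarrow> s < t \<Longrightarrow> (f has_real_derivative f' s) (at s)"
    and w': "\<And>s. a \<le> s \<Longrightarrow> s < t \<Longrightarrow> (w has_real_derivative w' s) (at s)"
    and w'_nonneg: "\<And>s. a \<le> s \<Longrightarrow> s < t \<Longrightarrow> w' s \<ge> 0"
    and max: "\<And>s. a \<le> s \<Longrightarrow> s \<le> t \<Longrightarrow> f s \<le> f t"
    and bdry: "((\<lambda>s. w s * (f t - f s)) \<longlongrightarrow> 0) (at_left t)"
    and int: "(\<lambda>s. w s * f' s) integrable_on {a..t}"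
  shows "w a * (f t - f a) \<le> integral {a..t} (\<lambda>s. w s * f' s)"
proof -
  let ?I = "\<lambda>x. integral {a..x} (\<lambda>s. w s * f' s)"
  have wcont: "continuous_on {a..x} w" if "x < t" for x
    by (rule DERIV_continuous_on[where D = w'], rule has_field_derivative_at_within, rule w')
       (use that in auto)
  have key: "w a * (f t - f a) - w x * (f t - f x) \<le> ?I x" if x: "a < x" "x < t" for x
  proof -
    \<comment> \<open>Only the upper limit needs to stay away from the singularity of w at t.\<close>
    have ibp: "((\<lambda>s. w' s * (f s - f t) + w s * f' s) has_integral w x * (f x - f t) - w a * (f a - f t)) {a..x}"
    proof (rule fundamental_theorem_of_calculus_interior)
      show "continuous_on {a..x} (\<lambda>s. w s * (f s - f t))"
        by (intro continuous_intros wcont continuous_on_subset[OF cont]) (use x in auto)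
      show "((\<lambda>s. w s * (f s - f t)) has_vector_derivative w' s * (f s - f t) + w s * f' s) (at s)"
        if "s \<in> {a<..<x}" for s
        unfolding has_real_derivative_iff_has_vector_derivative[symmetric]
        using that x by (auto intro!: derivative_eq_intros w' f')
    qed (use x in auto)
    have "((\<lambda>s. w s * f' s) has_integral ?I x) {a..x}"
      by (intro integrable_integral integrable_on_subinterval[OF int]) (use x in auto)
    moreover have "w' s * (f s - f t) \<le> 0" if "a < s" "s < x" for s
      using w'_nonneg[of s] max[of s] that x by (intro mult_nonneg_nonpos) auto
    ultimately have "w x * (f x - f t) - w a * (f a - f t) \<le> ?I x"
      using has_integral_le_interior[OF ibp] by simp
    then show ?thesis by (simp add: algebra_simps)
  qed
  have "continuous_on {a..t} ?I" by (rule indefinite_integral_continuous_1[OF int])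
  then have "(?I \<longlongrightarrow> ?I t) (at t within {a..t})"
    using \<open>a < t\<close> by (auto simp: continuous_on)
  then have lim: "(?I \<longlongrightarrow> ?I t) (at_left t)"
    using \<open>a < t\<close> by (simp add: at_within_Icc_at_left)
  show ?thesis
  proof (rule tendsto_le[OF _ lim])
    show "((\<lambda>x. w a * (f t - f a) - w x * (f t - f x)) \<longlongrightarrow> w a * (f t - f a)) (at_left t)"
      using tendsto_diff[OF tendsto_const bdry] by simp
    show "\<forall>\<^sub>F x in at_left t. w a * (f t - f a) - w x * (f t - f x) \<le> ?I x"
      using eventually_at_left_real[OF \<open>a < t\<close>] by (rule eventually_mono) (use key in auto)
  qed simp
qed

lemma powr_kernel_derivative:
  fixes r :: real assumes "s < t"
  shows "((\<lambda>s. (t - s) powr - r) has_real_derivative r * (t - s) powr (- r - 1)) (at s)"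
proof -
  have "((\<lambda>s. (t - s) powr - r) has_real_derivative (- r * (t - s) powr (- r - 1)) * (- 1)) (at s)"
    by (rule DERIV_chain2[OF has_real_derivative_powr])
       (use assms in \<open>auto intro!: derivative_eq_intros\<close>)
  then show ?thesis by simp
qed

text \<open>
  Differentiability at \<open>t\<close> makes \<open>f t - f s\<close> of order \<open>t - s\<close>, which beats the singularity.
\<close>

lemma powr_kernel_boundary_term:
  fixes f :: "real \<Rightarrow> real"
  assumes "f differentiable (at t)" "r < 1"
  shows "((\<lambda>s. (t - s) powr - r * (f t - f s)) \<longlongrightarrow> 0) (at_left t)"
proof -
  obtain D where "(f has_real_derivative D) (at t)"
    using assms real_differentiable_def by blast
  then have "((\<lambda>s. (f s - f t) / (s - t)) \<longlongrightarrow> D) (at_left t)"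
    using has_field_derivative_at_within[of f D t "{..<t}"] by (simp add: has_field_derivative_iff)
  moreover have "((\<lambda>s. (t - s) powr (1 - r)) \<longlongrightarrow> (t - t) powr (1 - r)) (at_left t)"
    by (intro tendsto_powr' tendsto_diff tendsto_const tendsto_ident_at)
       (use assms in \<open>auto intro!: eventually_at_leftI[of "t - 1"]\<close>)
  ultimately have "((\<lambda>s. (t - s) powr (1 - r) * ((f s - f t) / (s - t))) \<longlongrightarrow> 0) (at_left t)"
    using tendsto_mult by fastforce
  moreover have "\<forall>\<^sub>F s in at_left t. (t - s) powr (1 - r) * ((f s - f t) / (s - t)) = (t - s) powr - r * (f t - f s)"
  proof (rule eventually_at_leftI[of "t - 1"])
    fix s assume "s \<in> {t - 1<..<t}"
    then have "(t - s) powr (1 - r) = (t - s) * (t - s) powr - r"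
      using powr_add[of "t - s" 1 "- r"] by simp
    then show "(t - s) powr (1 - r) * ((f s - f t) / (s - t)) = (t - s) powr - r * (f t - f s)"
      using \<open>s \<in> _\<close> by (simp add: divide_simps) (simp add: algebra_simps)
  qed simp
  ultimately show ?thesis using tendsto_cong by fastforce
qed

lemma caputo_integrand_real:
  "caputo_integrand r h t = (\<lambda>s. (t - s) powr - r * vector_derivative h (at s))"
  for h :: "real \<Rightarrow> real"
  by (simp add: caputo_integrand_def fun_eq_iff powr_minus divide_inverse)

lemma differentiable_has_real_derivative:
  "h differentiable (at s) \<Longrightarrow> (h has_real_derivative vector_derivative h (at s)) (at s)"
  for h :: "real \<Rightarrow> real"
  by (simp add: has_real_derivative_iff_has_vector_derivative vector_derivative_works)

text \<open>
  The maximum principle for Caputo derivatives.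
\<close>

lemma caputo_deriv_at_maximum:
  fixes h :: "real \<Rightarrow> real"
  assumes r: "0 < r" "r < 1" and t: "0 < t" and ex: "caputo_deriv_exists r h t"
    and cont: "continuous_on {0..t} h" and diff: "h differentiable (at t)"
    and max: "\<And>s. 0 \<le> s \<Longrightarrow> s \<le> t \<Longrightarrow> h s \<le> h t"
  shows "t powr - r * (h t - h 0) / Gamma (1 - r) \<le> caputo_deriv r h t"
proof -
  have "(t - 0) powr - r * (h t - h 0) \<le> integral {0..t} (\<lambda>s. (t - s) powr - r * vector_derivative h (at s))"
  proof (rule integral_by_parts_at_maximum[OF t cont _ powr_kernel_derivative])
    show "(\<lambda>s. (t - s) powr - r * vector_derivative h (at s)) integrable_on {0..t}"
      using ex by (simp add: caputo_deriv_exists_def caputo_integrand_real)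
    show "((\<lambda>s. (t - s) powr - r * (h t - h s)) \<longlongrightarrow> 0) (at_left t)"
      by (rule powr_kernel_boundary_term) fact+
  qed (use ex r max in \<open>auto simp: caputo_deriv_exists_def intro: differentiable_has_real_derivative\<close>)
  then show ?thesis
    using Gamma_real_pos[of "1 - r"] r by (simp add: caputo_deriv_def caputo_integrand_real divide_right_mono)
qed


text \<open>
  From a minimum over the past to a later maximum the Caputo derivative grows. Over \<open>{t0..t1}\<close> this is
  integration by parts at the maximum \<open>t1\<close>. Over \<open>{0..t0}\<close> the difference of the two integrals has the
  weight \<open>(t0 - s) powr - r - (t1 - s) powr - r\<close>, which is nonnegative and, since the kernel is convex,
  increasing in \<open>s\<close>; so integration by parts applies once more, to \<open>- h\<close> at \<open>t0\<close>.
\<close>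

lemma caputo_deriv_min_to_max:
  fixes h :: "real \<Rightarrow> real"
  assumes r: "0 < r" "r < 1" and t: "0 < t0" "t0 < t1"
    and ex: "caputo_deriv_exists r h t0" "caputo_deriv_exists r h t1"
    and cont: "continuous_on {0..t1} h" and diff1: "h differentiable (at t1)"
    and min: "\<And>s. 0 \<le> s \<Longrightarrow> s \<le> t0 \<Longrightarrow> h t0 \<le> h s"
    and max: "\<And>s. t0 \<le> s \<Longrightarrow> s \<le> t1 \<Longrightarrow> h s \<le> h t1"
  shows "caputo_deriv r h t0 + (t1 - t0) powr - r * (h t1 - h t0) / Gamma (1 - r) \<le> caputo_deriv r h t1"
proof -
  let ?h' = "\<lambda>s. vector_derivative h (at s)"
  have int0: "(\<lambda>s. (t0 - s) powr - r * ?h' s) integrable_on {0..t0}"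
    and int1: "(\<lambda>s. (t1 - s) powr - r * ?h' s) integrable_on {0..t1}"
    and diff: "\<And>s. 0 < s \<Longrightarrow> s < t1 \<Longrightarrow> h differentiable (at s)"
    using ex by (simp_all add: caputo_deriv_exists_def caputo_integrand_real)
  have int10: "(\<lambda>s. (t1 - s) powr - r * ?h' s) integrable_on {0..t0}"
    and int01: "(\<lambda>s. (t1 - s) powr - r * ?h' s) integrable_on {t0..t1}"
    by (rule integrable_on_subinterval[OF int1]; use t in auto)+
  have A: "(t1 - t0) powr - r * (h t1 - h t0) \<le> integral {t0..t1} (\<lambda>s. (t1 - s) powr - r * ?h' s)"
  proof (rule integral_by_parts_at_maximum[OF t(2) _ _ powr_kernel_derivative])
    show "((\<lambda>s. (t1 - s) powr - r * (h t1 - h s)) \<longlongrightarrow> 0) (at_left t1)"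
      by (rule powr_kernel_boundary_term) fact+
    show "(h has_real_derivative ?h' s) (at s)" if "t0 < s" "s < t1" for s
      using that t diff by (intro differentiable_has_real_derivative) auto
    show "continuous_on {t0..t1} h" using cont by (rule continuous_on_subset) (use t in auto)
  qed (use int01 r max in auto)
  let ?w = "\<lambda>s. (t0 - s) powr - r - (t1 - s) powr - r"
  have "?w 0 * (- h t0 - - h 0) \<le> integral {0..t0} (\<lambda>s. ?w s * - ?h' s)"
  proof (rule integral_by_parts_at_maximum[OF t(1)])
    show "continuous_on {0..t0} (\<lambda>s. - h s)"
      by (intro continuous_intros continuous_on_subset[OF cont]) (use t in auto)
    show "((\<lambda>s. - h s) has_real_derivative - ?h' s) (at s)" if "0 < s" "s < t0" for s
      using that t diff by (intro DERIV_minus differentiable_has_real_derivative) auto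
    show "(?w has_real_derivative r * (t0 - s) powr (- r - 1) - r * (t1 - s) powr (- r - 1)) (at s)"
      if "0 \<le> s" "s < t0" for s
      using that t by (intro DERIV_diff powr_kernel_derivative) auto
    show "0 \<le> r * (t0 - s) powr (- r - 1) - r * (t1 - s) powr (- r - 1)" if "0 \<le> s" "s < t0" for s
      using that t r by (auto intro!: mult_left_mono powr_mono2')
    show "(\<lambda>s. ?w s * - ?h' s) integrable_on {0..t0}"
      using integrable_diff[OF int10 int0] by (simp add: algebra_simps)
    have d0: "h differentiable (at t0)" using diff t by auto
    have lim0: "((\<lambda>s. (t0 - s) powr - r * (h t0 - h s)) \<longlongrightarrow> 0) (at_left t0)"
      by (rule powr_kernel_boundary_term) fact+
    have "(h \<longlongrightarrow> h t0) (at_left t0)"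
      using differentiable_imp_continuous_within[OF d0] unfolding continuous_within
      by (rule tendsto_within_subset) simp
    then have "((\<lambda>s. (t1 - s) powr - r * (h t0 - h s)) \<longlongrightarrow> (t1 - t0) powr - r * (h t0 - h t0)) (at_left t0)"
      by (intro tendsto_intros) (use t in auto)
    from tendsto_diff[OF this lim0]
    show "((\<lambda>s. ?w s * (- h t0 - - h s)) \<longlongrightarrow> 0) (at_left t0)" by (simp add: algebra_simps)
  qed (use min in auto)
  moreover have "?w 0 * (- h t0 - - h 0) \<ge> 0"
    using min[of 0] t r by (auto intro!: mult_nonneg_nonneg powr_mono2')
  moreover have "integral {0..t0} (\<lambda>s. ?w s * - ?h' s) =
      integral {0..t0} (\<lambda>s. (t1 - s) powr - r * ?h' s) - integral {0..t0} (\<lambda>s. (t0 - s) powr - r * ?h' s)"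
    using integral_diff[OF int10 int0] by (simp add: algebra_simps)
  moreover have "integral {0..t1} (\<lambda>s. (t1 - s) powr - r * ?h' s) =
      integral {0..t0} (\<lambda>s. (t1 - s) powr - r * ?h' s) + integral {t0..t1} (\<lambda>s. (t1 - s) powr - r * ?h' s)"
    using Henstock_Kurzweil_Integration.integral_combine[OF _ _ int1, of t0] t by simp
  ultimately have "integral {0..t0} (\<lambda>s. (t0 - s) powr - r * ?h' s) + (t1 - t0) powr - r * (h t1 - h t0)
      \<le> integral {0..t1} (\<lambda>s. (t1 - s) powr - r * ?h' s)"
    using A by linarith
  from divide_right_mono[OF this, of "Gamma (1 - r)"] show ?thesis
    using Gamma_real_pos[of "1 - r"] r
    by (simp add: caputo_deriv_def caputo_integrand_real add_divide_distrib)
qed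

lemma caputo_deriv_linear_combination:
  fixes f g :: "real \<Rightarrow> real"
  assumes "caputo_deriv_exists r f t" "caputo_deriv_exists r g t"
  shows "caputo_deriv_exists r (\<lambda>s. a * f s + b * g s + c) t" (is "caputo_deriv_exists r ?h t")
    and "caputo_deriv r (\<lambda>s. a * f s + b * g s + c) t = a * caputo_deriv r f t + b * caputo_deriv r g t"
proof -
  have diff: "f differentiable (at s)" "g differentiable (at s)" if "0 < s" "s < t" for s
    using assms that by (auto simp: caputo_deriv_exists_def)
  have deriv: "vector_derivative ?h (at s) = a * vector_derivative f (at s) + b * vector_derivative g (at s)"
    if "0 < s" "s < t" for s
    using diff[OF that, THEN differentiable_has_real_derivative]
    unfolding has_real_derivative_iff_has_vector_derivative
    by (auto intro!: vector_derivative_at derivative_eq_intros)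
  let ?F = "\<lambda>s. a * caputo_integrand r f t s + b * caputo_integrand r g t s"
  have int: "(?F has_integral a * integral {0..t} (caputo_integrand r f t) + b * integral {0..t} (caputo_integrand r g t)) {0..t}"
    using assms unfolding caputo_deriv_exists_def
    by (intro has_integral_add has_integral_mult_right integrable_integral) auto
  have "(caputo_integrand r ?h t has_integral
      a * integral {0..t} (caputo_integrand r f t) + b * integral {0..t} (caputo_integrand r g t)) {0..t}"
  proof (rule has_integral_spike_finite[OF _ _ int, of "{0, t}"])
    fix s assume "s \<in> {0..t} - {0, t}"
    then have "0 < s" "s < t" by auto
    then show "caputo_integrand r ?h t s = ?F s"
      unfolding caputo_integrand_def by (subst deriv) (simp_all add: algebra_simps)
  qed simp
  then show "caputo_deriv r ?h t = a * caputo_deriv r f t + b * caputo_deriv r g t"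
    and "caputo_deriv_exists r ?h t"
    using diff by (auto simp: caputo_deriv_def caputo_deriv_exists_def integral_unique algebra_simps
        has_integral_integrable intro!: derivative_intros add_divide_distrib)
qed

lemma caputo_deriv_rescale:
  fixes h :: "real \<Rightarrow> real"
  assumes c: "c > 0" and t: "t > 0" and ex: "caputo_deriv_exists r h (c * t)"
  shows "caputo_deriv_exists r (\<lambda>s. h (c * s)) t" (is "caputo_deriv_exists r ?g t")
    and "caputo_deriv r (\<lambda>s. h (c * s)) t = c powr r * caputo_deriv r h (c * t)"
proof -
  have der: "(?g has_real_derivative c * vector_derivative h (at (c * s))) (at s)" if "0 < s" "s < t" for s
  proof -
    have "(h has_real_derivative vector_derivative h (at (c * s))) (at (c * s))"
      using ex that c by (intro differentiable_has_real_derivative) (auto simp: caputo_deriv_exists_def)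
    then have "((\<lambda>s. h (c * s)) has_real_derivative vector_derivative h (at (c * s)) * c) (at s)"
      by (rule DERIV_chain2[where g = "\<lambda>s. c * s"]) (auto intro!: derivative_eq_intros)
    then show ?thesis by (simp add: mult.commute)
  qed
  let ?I = "integral {0..c * t} (caputo_integrand r h (c * t))"
  have "(caputo_integrand r h (c * t) has_integral ?I) {0..c * t}"
    using ex by (auto simp: caputo_deriv_exists_def)
  from has_integral_mult_right[OF has_integral_stretch_real[OF this, of c], of "c powr (1 + r)"]
  have int: "((\<lambda>s. c powr (1 + r) * caputo_integrand r h (c * t) (c * s)) has_integral c powr r * ?I) {0..t}"
    using c t by (simp add: powr_add image_divide_atLeastAtMost)
  have "(caputo_integrand r ?g t has_integral c powr r * ?I) {0..t}"
  proof (rule has_integral_spike_finite[OF _ _ int, of "{0, t}"])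
    fix s assume s: "s \<in> {0..t} - {0, t}"
    then have "vector_derivative ?g (at s) = c * vector_derivative h (at (c * s))"
      using der[of s] by (simp add: has_real_derivative_iff_has_vector_derivative vector_derivative_at)
    moreover have "(c * t - c * s) powr r = c powr r * (t - s) powr r"
      using s c by (simp add: right_diff_distrib[symmetric] powr_mult)
    ultimately show "caputo_integrand r ?g t s = c powr (1 + r) * caputo_integrand r h (c * t) (c * s)"
      using c by (simp add: caputo_integrand_def powr_add)
  qed simp
  then show "caputo_deriv_exists r ?g t"
    and "caputo_deriv r ?g t = c powr r * caputo_deriv r h (c * t)"
    using der real_differentiable_def
    by (fastforce simp: caputo_deriv_exists_def caputo_deriv_def integral_unique has_integral_integrable)+
qed

lemma caputo_deriv_inner:
  fixes u :: "real \<Rightarrow> 'h::real_inner"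
  assumes "caputo_deriv_exists r u t"
  shows "caputo_deriv_exists r (\<lambda>s. u s \<bullet> b) t" (is "caputo_deriv_exists r ?v t")
    and "caputo_deriv r (\<lambda>s. u s \<bullet> b) t = caputo_deriv r u t \<bullet> b"
proof -
  have der: "(?v has_vector_derivative vector_derivative u (at s) \<bullet> b) (at s)" if "0 < s" "s < t" for s
  proof -
    have "(u has_vector_derivative vector_derivative u (at s)) (at s)"
      using assms that by (auto simp: caputo_deriv_exists_def vector_derivative_works)
    then show ?thesis by (rule bounded_linear.has_vector_derivative[OF bounded_linear_inner_left])
  qed
  have "(caputo_integrand r u t has_integral integral {0..t} (caputo_integrand r u t)) {0..t}"
    using assms by (auto simp: caputo_deriv_exists_def)
  from has_integral_linear[OF this bounded_linear_inner_left, of b]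
  have int: "((\<lambda>s. caputo_integrand r u t s \<bullet> b) has_integral integral {0..t} (caputo_integrand r u t) \<bullet> b) {0..t}"
    by (simp add: o_def)
  have "(caputo_integrand r ?v t has_integral integral {0..t} (caputo_integrand r u t) \<bullet> b) {0..t}"
  proof (rule has_integral_spike_finite[OF _ _ int, of "{0, t}"])
    fix s assume "s \<in> {0..t} - {0, t}"
    then show "caputo_integrand r ?v t s = caputo_integrand r u t s \<bullet> b"
      using der[of s] by (simp add: caputo_integrand_def vector_derivative_at)
  qed simp
  then show "caputo_deriv_exists r ?v t" "caputo_deriv r ?v t = caputo_deriv r u t \<bullet> b"
    using differentiableI_vector[OF der]
    by (auto simp: caputo_deriv_exists_def caputo_deriv_def integral_unique has_integral_integrable)
qed

section \<open>The multi-term relaxation equation\<close>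

locale fractional_orders =
  fixes M :: nat and \<rho> q :: "nat \<Rightarrow> real"
  assumes M: "1 \<le> M"
    and order_pos: "\<And>j. j \<in> {1..M} \<Longrightarrow> 0 < \<rho> j"
    and order_less_1: "\<And>j. j \<in> {1..M} \<Longrightarrow> \<rho> j < 1"
    and weight_pos: "\<And>j. j \<in> {1..M} \<Longrightarrow> 0 < q j"
begin

definition multi_caputo :: "(real \<Rightarrow> real) \<Rightarrow> real \<Rightarrow> real" where
  "multi_caputo h t = (\<Sum>j=1..M. q j * caputo_deriv (\<rho> j) h t)"

text \<open>
  The multi-term Caputo derivative of \<open>h\<close> is the convolution of this kernel with the derivative of \<open>h\<close>.
\<close>

definition kernel :: "real \<Rightarrow> real" where
  "kernel t = (\<Sum>j=1..M. q j * (t powr - \<rho> j / Gamma (1 - \<rho> j)))"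

text \<open>
  The functions to which the maximum principle applies. The value \<open>\<tau>\<close> itself is excluded, because a
  solution of the backward problem satisfies the equation only before the final time.
\<close>

definition admissible :: "real \<Rightarrow> (real \<Rightarrow> real) \<Rightarrow> bool" where
  "admissible \<tau> h \<longleftrightarrow> continuous_on {0..<\<tau>} h \<and>
     (\<forall>t\<in>{0<..<\<tau>}. \<forall>j\<in>{1..M}. caputo_deriv_exists (\<rho> j) h t)"

definition solves :: "real \<Rightarrow> real \<Rightarrow> (real \<Rightarrow> real) \<Rightarrow> bool" where
  "solves \<tau> lam h \<longleftrightarrow> admissible \<tau> h \<and> (\<forall>t\<in>{0<..<\<tau>}. multi_caputo h t + lam * h t = 0)"

lemma kernel_pos: "t > 0 \<Longrightarrow> kernel t > 0"
  unfolding kernel_def using M order_less_1 weight_pos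
  by (intro sum_pos) (auto intro!: mult_pos_pos divide_pos_pos Gamma_real_pos)

lemma admissible_exists:
  "admissible \<tau> h \<Longrightarrow> 0 < t \<Longrightarrow> t < \<tau> \<Longrightarrow> j \<in> {1..M} \<Longrightarrow> caputo_deriv_exists (\<rho> j) h t"
  by (simp add: admissible_def)

lemma admissible_continuous: "admissible \<tau> h \<Longrightarrow> t < \<tau> \<Longrightarrow> continuous_on {0..t} h"
  unfolding admissible_def by (auto elim: continuous_on_subset)

lemma admissible_differentiable:
  assumes h: "admissible \<tau> h" and t: "0 < t" "t < \<tau>"
  shows "h differentiable (at t)"
proof -
  have "caputo_deriv_exists (\<rho> 1) h ((t + \<tau>) / 2)"
    using t M by (intro admissible_exists[OF h]) auto
  then show ?thesis using t by (auto simp: caputo_deriv_exists_def)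
qed

lemma
  assumes f: "admissible \<tau> f" and g: "admissible \<tau> g"
  shows admissible_linear_combination: "admissible \<tau> (\<lambda>s. a * f s + b * g s + c)"
    and multi_caputo_linear_combination: "0 < t \<Longrightarrow> t < \<tau> \<Longrightarrow>
      multi_caputo (\<lambda>s. a * f s + b * g s + c) t = a * multi_caputo f t + b * multi_caputo g t"
proof -
  show "admissible \<tau> (\<lambda>s. a * f s + b * g s + c)"
    using f g caputo_deriv_linear_combination(1) unfolding admissible_def
    by (auto intro!: continuous_intros)
  show "multi_caputo (\<lambda>s. a * f s + b * g s + c) t = a * multi_caputo f t + b * multi_caputo g t"
    if "0 < t" "t < \<tau>"
    unfolding multi_caputo_def sum_distrib_left sum.distrib[symmetric]
    using caputo_deriv_linear_combination(2)[OF admissible_exists[OF f that] admissible_exists[OF g that]]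
    by (intro sum.cong) (simp_all add: distrib_left mult.left_commute)
qed

lemma multi_caputo_at_maximum:
  assumes h: "admissible \<tau> h" and t: "0 < t" "t < \<tau>"
    and max: "\<And>s. 0 \<le> s \<Longrightarrow> s \<le> t \<Longrightarrow> h s \<le> h t"
  shows "kernel t * (h t - h 0) \<le> multi_caputo h t"
proof -
  have "q j * (t powr - \<rho> j * (h t - h 0) / Gamma (1 - \<rho> j)) \<le> q j * caputo_deriv (\<rho> j) h t"
    if "j \<in> {1..M}" for j
    using that t max by (intro mult_left_mono caputo_deriv_at_maximum admissible_exists[OF h]
        admissible_continuous[OF h] admissible_differentiable[OF h] order_pos order_less_1
        less_imp_le[OF weight_pos]) auto
  from sum_mono[of "{1..M}", OF this] show ?thesis
    unfolding multi_caputo_def kernel_def sum_distrib_right by (simp add: mult_ac)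
qed

lemma multi_caputo_at_minimum:
  assumes h: "admissible \<tau> h" and t: "0 < t" "t < \<tau>"
    and min: "\<And>s. 0 \<le> s \<Longrightarrow> s \<le> t \<Longrightarrow> h t \<le> h s"
  shows "multi_caputo h t \<le> kernel t * (h t - h 0)"
proof -
  have "kernel t * (- h t - - h 0) \<le> multi_caputo (\<lambda>s. - h s) t"
    using multi_caputo_at_maximum[of \<tau> "\<lambda>s. - h s" t] t min
      admissible_linear_combination[OF h h, of "-1" 0 0] by simp
  moreover have "multi_caputo (\<lambda>s. - h s) t = - multi_caputo h t"
    using multi_caputo_linear_combination[OF h h t, of "-1" 0 0] by simp
  ultimately show ?thesis by (simp add: algebra_simps)
qed

lemma argmin:
  fixes h :: "real \<Rightarrow> real"
  assumes "continuous_on {a..b} h" "a \<le> b"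
  obtains t where "a \<le> t" "t \<le> b" "\<And>s. a \<le> s \<Longrightarrow> s \<le> b \<Longrightarrow> h t \<le> h s"
  using continuous_attains_inf[of "{a..b}" h] assms by auto

text \<open>
  At a negative minimum, which cannot be at 0, both \<open>multi_caputo h\<close> and \<open>lam * h\<close> would be nonpositive,
  and the second negative.
\<close>

lemma minimum_principle:
  assumes h: "admissible \<tau> h" and lam: "lam > 0" and init: "h 0 \<ge> 0"
    and super: "\<And>t. 0 < t \<Longrightarrow> t < \<tau> \<Longrightarrow> multi_caputo h t + lam * h t \<ge> 0"
    and t: "0 \<le> t" "t < \<tau>"
  shows "h t \<ge> 0"
proof (rule ccontr)
  assume neg: "\<not> h t \<ge> 0"
  obtain m where m: "0 \<le> m" "m \<le> t" "\<And>s. 0 \<le> s \<Longrightarrow> s \<le> t \<Longrightarrow> h m \<le> h s"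
    using argmin[OF admissible_continuous[OF h t(2)] t(1)] by metis
  have "h m < 0" using m(3)[of t] t neg by auto
  then have "m > 0" using init m(1) by (cases "m = 0") auto
  have "multi_caputo h m \<le> kernel m * (h m - h 0)"
    using m t \<open>m > 0\<close> by (intro multi_caputo_at_minimum[OF h]) auto
  also have "\<dots> \<le> 0"
    using kernel_pos[OF \<open>m > 0\<close>] \<open>h m < 0\<close> init by (intro mult_nonneg_nonpos) auto
  finally have "multi_caputo h m + lam * h m < 0"
    using lam \<open>h m < 0\<close> by (simp add: add_nonpos_neg mult_pos_neg)
  with super[of m] m t \<open>m > 0\<close> show False by simp
qed

lemma solution_unique:
  assumes f: "solves \<tau> lam f" and g: "solves \<tau> lam g" and lam: "lam > 0"
    and init: "f 0 = g 0" and t: "0 \<le> t" "t < \<tau>"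
  shows "f t = g t"
proof -
  have le: "u t \<le> v t" if u: "solves \<tau> lam u" and v: "solves \<tau> lam v" and "u 0 = v 0" for u v
  proof -
    have adm: "admissible \<tau> u" "admissible \<tau> v" using u v by (auto simp: solves_def)
    have "-1 * u t + 1 * v t + 0 \<ge> 0"
    proof (rule minimum_principle[OF admissible_linear_combination[OF adm] lam _ _ t])
      fix s assume "0 < s" "s < \<tau>"
      then have "multi_caputo u s + lam * u s = 0" "multi_caputo v s + lam * v s = 0"
        using u v by (auto simp: solves_def)
      with \<open>0 < s\<close> \<open>s < \<tau>\<close>
      show "multi_caputo (\<lambda>s. -1 * u s + 1 * v s + 0) s + lam * (-1 * u s + 1 * v s + 0) \<ge> 0"
        by (subst multi_caputo_linear_combination[OF adm]) (simp_all add: algebra_simps)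
    qed (use that in auto)
    then show ?thesis by simp
  qed
  show ?thesis using le[OF f g init] le[OF g f init[symmetric]] by simp
qed

text \<open>
  Asking for solutions on all of \<open>{0..}\<close> makes the class closed under the rescalings
  \<open>h (c * t)\<close>, on which the derivative bound relies. Continuity of the derivative makes the
  Caputo integral for \<open>t\<close>, taken only over \<open>{0..s}\<close>, differentiable in \<open>s\<close> for \<open>0 < s < t\<close>.
\<close>

definition relaxation :: "real \<Rightarrow> (real \<Rightarrow> real) \<Rightarrow> bool" where
  "relaxation lam h \<longleftrightarrow> (\<forall>\<tau>. solves \<tau> lam h) \<and> h 0 = 1 \<and>
     continuous_on {0<..} (\<lambda>t. vector_derivative h (at t))"

context
  fixes lam :: real and h :: "real \<Rightarrow> real"
  assumes lam: "lam > 0" and h: "relaxation lam h"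
begin

lemma relaxation_admissible: "admissible \<tau> h" and relaxation_init: "h 0 = 1"
  and relaxation_equation: "t > 0 \<Longrightarrow> multi_caputo h t = - lam * h t"
proof -
  show "admissible \<tau> h" "h 0 = 1" using h by (auto simp: relaxation_def solves_def)
  show "multi_caputo h t = - lam * h t" if "t > 0"
  proof -
    have "solves (t + 1) lam h" using h by (simp add: relaxation_def)
    then have "multi_caputo h t + lam * h t = 0" using that unfolding solves_def by auto
    then show ?thesis by simp
  qed
qed

lemma relaxation_continuous: "continuous_on {0..t} h"
  by (rule admissible_continuous[OF relaxation_admissible, of _ "t + 1"]) simp

lemma relaxation_has_derivative:
  "t > 0 \<Longrightarrow> (h has_real_derivative vector_derivative h (at t)) (at t)"
  by (rule differentiable_has_real_derivative)
     (rule admissible_differentiable[OF relaxation_admissible, of _ "t + 1"], auto)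

lemma relaxation_exists: "t > 0 \<Longrightarrow> j \<in> {1..M} \<Longrightarrow> caputo_deriv_exists (\<rho> j) h t"
  by (rule admissible_exists[OF relaxation_admissible, of _ "t + 1"]) auto

lemma relaxation_pos:
  assumes "t \<ge> 0" shows "h t > 0"
proof (rule ccontr)
  assume "\<not> h t > 0"
  obtain m where m: "0 \<le> m" "m \<le> t" "\<And>s. 0 \<le> s \<Longrightarrow> s \<le> t \<Longrightarrow> h m \<le> h s"
    using argmin[OF relaxation_continuous assms] by metis
  have hm: "h m \<le> 0" using m(3)[of t] assms \<open>\<not> h t > 0\<close> by auto
  then have "m > 0" using relaxation_init m(1) by (cases "m = 0") auto
  have "multi_caputo h m \<le> kernel m * (h m - h 0)"
    using m \<open>m > 0\<close> by (intro multi_caputo_at_minimum[OF relaxation_admissible, of _ "t + 1"]) auto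
  also have "\<dots> < 0"
    using kernel_pos[OF \<open>m > 0\<close>] hm relaxation_init by (intro mult_pos_neg) auto
  finally have "lam * h m > 0" using relaxation_equation[OF \<open>m > 0\<close>] by simp
  with lam hm show False by (simp add: zero_less_mult_iff)
qed

lemma relaxation_le_1:
  assumes "t \<ge> 0" shows "h t \<le> 1"
proof -
  note adm = relaxation_admissible
  have "-1 * h t + 0 * h t + 1 \<ge> 0"
  proof (rule minimum_principle[OF admissible_linear_combination[OF adm adm] lam])
    fix s assume "0 < s" "s < t + 1"
    then show "multi_caputo (\<lambda>s. -1 * h s + 0 * h s + 1) s + lam * (-1 * h s + 0 * h s + 1) \<ge> 0"
      using lam by (subst multi_caputo_linear_combination[OF adm adm, of _ "t + 1"])
        (auto simp: relaxation_equation algebra_simps)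
  qed (use assms relaxation_init in auto)
  then show ?thesis by simp
qed

text \<open>
  If \<open>h\<close> increased somewhere, there would be a point \<open>t0\<close> where it is minimal over the past and a later
  point \<open>t1\<close> where it is maximal over \<open>{t0..t1}\<close> with \<open>h t0 < h t1\<close>. Then \<open>multi_caputo h\<close> does not
  decrease from \<open>t0\<close> to \<open>t1\<close>, while the equation makes it equal to \<open>- lam * h\<close>, which does decrease.
\<close>

lemma relaxation_antimono:
  assumes ab: "0 \<le> a" "a \<le> b" shows "h b \<le> h a"
proof (rule ccontr)
  assume "\<not> h b \<le> h a"
  then have less: "h a < h b" "a < b" using ab by (auto simp: not_le order.strict_iff_order)
  obtain t0 where t0: "0 \<le> t0" "t0 \<le> b" and min: "\<And>s. 0 \<le> s \<Longrightarrow> s \<le> b \<Longrightarrow> h t0 \<le> h s"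
    using argmin[OF relaxation_continuous, of b] ab by auto
  have "h t0 < h b" using min[of a] less ab by auto
  then have "t0 < b" using t0 by (cases "t0 = b") auto
  have "h t0 < 1" using \<open>h t0 < h b\<close> relaxation_le_1[of b] ab by auto
  then have "t0 > 0" using t0 relaxation_init by (cases "t0 = 0") auto
  obtain t1 where t1: "t0 \<le> t1" "t1 \<le> b" and max': "\<And>s. t0 \<le> s \<Longrightarrow> s \<le> b \<Longrightarrow> - h t1 \<le> - h s"
    using argmin[of t0 b "\<lambda>s. - h s"] \<open>t0 < b\<close> t0
      continuous_on_subset[OF continuous_on_minus[OF relaxation_continuous[of b]], of "{t0..b}"] by auto
  have "h t0 < h t1" using max'[of b] \<open>h t0 < h b\<close> \<open>t0 < b\<close> by auto
  then have "t0 < t1" using t1 by (cases "t0 = t1") auto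
  have "caputo_deriv (\<rho> j) h t0 \<le> caputo_deriv (\<rho> j) h t1" if j: "j \<in> {1..M}" for j
  proof -
    have "caputo_deriv (\<rho> j) h t0 + (t1 - t0) powr - \<rho> j * (h t1 - h t0) / Gamma (1 - \<rho> j)
        \<le> caputo_deriv (\<rho> j) h t1"
      using \<open>0 < t0\<close> \<open>t0 < t1\<close> t1 min max' j
      by (intro caputo_deriv_min_to_max order_pos order_less_1 relaxation_exists relaxation_continuous
          admissible_differentiable[OF relaxation_admissible, of _ "t1 + 1"]) auto
    moreover have "(t1 - t0) powr - \<rho> j * (h t1 - h t0) / Gamma (1 - \<rho> j) \<ge> 0"
      using \<open>h t0 < h t1\<close> Gamma_real_pos[of "1 - \<rho> j"] order_less_1[OF j] by simp
    ultimately show ?thesis by linarith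
  qed
  then have "multi_caputo h t0 \<le> multi_caputo h t1"
    unfolding multi_caputo_def using weight_pos by (intro sum_mono mult_left_mono) (auto intro: less_imp_le)
  then have "lam * h t1 \<le> lam * h t0"
    using relaxation_equation \<open>0 < t0\<close> \<open>t0 < t1\<close> by simp
  with \<open>h t0 < h t1\<close> lam show False by simp
qed

lemma relaxation_derivative_nonpos:
  assumes "t > 0" shows "vector_derivative h (at t) \<le> 0"
proof (rule tendsto_upperbound)
  show "((\<lambda>s. (h s - h t) / (s - t)) \<longlongrightarrow> vector_derivative h (at t)) (at_right t)"
    using has_field_derivative_at_within[OF relaxation_has_derivative[OF assms], of "{t<..}"]
    by (simp add: has_field_derivative_iff)
  show "\<forall>\<^sub>F s in at_right t. (h s - h t) / (s - t) \<le> 0"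
    using assms by (intro eventually_at_rightI[of t "t + 1"])
      (auto intro!: divide_nonpos_pos relaxation_antimono)
qed simp

lemma relaxation_caputo_nonpos:
  assumes "t > 0" "j \<in> {1..M}" shows "caputo_deriv (\<rho> j) h t \<le> 0"
proof -
  have "(caputo_integrand (\<rho> j) h t has_integral integral {0..t} (caputo_integrand (\<rho> j) h t)) {0..t}"
    using relaxation_exists[OF assms] by (auto simp: caputo_deriv_exists_def)
  from has_integral_le_interior[OF this has_integral_0]
  have "integral {0..t} (caputo_integrand (\<rho> j) h t) \<le> 0"
    using relaxation_derivative_nonpos by (simp add: caputo_integrand_real mult_nonneg_nonpos)
  then show ?thesis
    using Gamma_real_pos[of "1 - \<rho> j"] order_less_1[OF assms(2)]
    by (simp add: caputo_deriv_def divide_nonpos_pos)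
qed

text \<open>
  The rescaled function \<open>h (c * t)\<close> satisfies an equation whose derivatives carry the factors
  \<open>c powr \<rho> j\<close>. Since \<open>c powr \<rho> j \<le> c\<close> and the Caputo derivatives of \<open>h\<close> are nonpositive, the function
  \<open>h (c * t) - h t + (c - 1)\<close> satisfies the hypotheses of the minimum principle. The bound does not
  involve \<open>lam\<close>.
\<close>

lemma relaxation_slow_decay:
  assumes c: "c > 1" and t: "t \<ge> 0" shows "h t - h (c * t) \<le> c - 1"
proof -
  let ?g = "\<lambda>s. h (c * s)"
  have ex: "caputo_deriv_exists (\<rho> j) ?g s" and eq: "caputo_deriv (\<rho> j) ?g s = c powr \<rho> j * caputo_deriv (\<rho> j) h (c * s)"
    if "s > 0" "j \<in> {1..M}" for s j
    using that c relaxation_exists[of "c * s" j] by (auto intro!: caputo_deriv_rescale)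
  have "continuous_on {0..<t+1} ?g"
    using c by (intro continuous_on_compose2[OF relaxation_continuous[of "c * (t + 1)"]] continuous_intros) auto
  then have g: "admissible (t + 1) ?g" using ex by (simp add: admissible_def)
  note adm = relaxation_admissible[of "t + 1"]
  have "1 * ?g t + -1 * h t + (c - 1) \<ge> 0"
  proof (rule minimum_principle[OF admissible_linear_combination[OF g adm] lam])
    fix s assume s: "0 < s" "s < t + 1"
    have "(c - 1) * caputo_deriv (\<rho> j) h (c * s) \<le> (c powr \<rho> j - 1) * caputo_deriv (\<rho> j) h (c * s)"
      if "j \<in> {1..M}" for j
      using that c s order_less_1[OF that] powr_mono[of "\<rho> j" 1 c]
      by (intro mult_right_mono_neg relaxation_caputo_nonpos) auto
    then have "(\<Sum>j=1..M. q j * ((c - 1) * caputo_deriv (\<rho> j) h (c * s)))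
      \<le> (\<Sum>j=1..M. q j * ((c powr \<rho> j - 1) * caputo_deriv (\<rho> j) h (c * s)))"
      using weight_pos by (intro sum_mono mult_left_mono) (auto intro: less_imp_le)
    then have "(c - 1) * multi_caputo h (c * s) \<le> multi_caputo ?g s - multi_caputo h (c * s)"
      unfolding multi_caputo_def using eq[OF s(1)]
      by (simp add: sum_distrib_left sum_subtractf[symmetric] algebra_simps)
    moreover have "multi_caputo h (c * s) = - lam * h (c * s)" "multi_caputo h s = - lam * h s"
      using c s by (intro relaxation_equation; simp)+
    moreover have "(c - 1) * (lam * h (c * s)) \<le> (c - 1) * (lam * 1)"
      using c s lam by (intro mult_left_mono relaxation_le_1) auto
    ultimately show "multi_caputo (\<lambda>s. 1 * ?g s + -1 * h s + (c - 1)) s + lam * (1 * ?g s + -1 * h s + (c - 1)) \<ge> 0"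
      by (subst multi_caputo_linear_combination[OF g adm s]) (simp add: algebra_simps)
  qed (use c t in auto)
  then show ?thesis by simp
qed

text \<open>
  This is the limit of \<open>relaxation_slow_decay\<close> as \<open>c\<close> tends to 1.
\<close>

lemma relaxation_derivative_bound:
  assumes t: "t > 0" shows "\<bar>vector_derivative h (at t)\<bar> \<le> 1 / t"
proof -
  have "- (1 / t) \<le> vector_derivative h (at t)"
  proof (rule tendsto_lowerbound)
    show "((\<lambda>s. (h s - h t) / (s - t)) \<longlongrightarrow> vector_derivative h (at t)) (at_right t)"
      using has_field_derivative_at_within[OF relaxation_has_derivative[OF t], of "{t<..}"]
      by (simp add: has_field_derivative_iff)
    show "\<forall>\<^sub>F s in at_right t. - (1 / t) \<le> (h s - h t) / (s - t)"
    proof (intro eventually_at_rightI[of t "t + 1"])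
      fix s assume "s \<in> {t<..<t+1}"
      then show "- (1 / t) \<le> (h s - h t) / (s - t)"
        using relaxation_slow_decay[of "s / t" t] t by (simp add: field_simps)
    qed simp
  qed simp
  with relaxation_derivative_nonpos[OF t] show ?thesis by (simp add: abs_le_iff)
qed

text \<open>
  On \<open>{0..t/2}\<close> the kernel is at most \<open>(t/2) powr - \<rho> j\<close> and the total decrease of \<open>h\<close> at most 1. On
  \<open>{t/2..t}\<close> the derivative is bounded by \<open>2 / t\<close> and the kernel is integrable.
\<close>

lemma relaxation_caputo_bound:
  assumes t: "t > 0" and j: "j \<in> {1..M}"
  shows "- integral {0..t} (caputo_integrand (\<rho> j) h t) \<le> (t/2) powr - \<rho> j * (1 + 1 / (1 - \<rho> j))"
proof -
  define r where "r = \<rho> j"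
  have r: "0 < r" "r < 1" using order_pos order_less_1 j by (auto simp: r_def)
  let ?f = "caputo_integrand r h t" and ?h' = "\<lambda>s. vector_derivative h (at s)"
  have int: "?f integrable_on {0..t}"
    using relaxation_exists[OF t j] by (auto simp: caputo_deriv_exists_def r_def)
  have int1: "?f integrable_on {0..t/2}" and int2: "?f integrable_on {t/2..t}"
    by (rule integrable_on_subinterval[OF int]; use t in auto)+
  have "(?h' has_integral h (t/2) - h 0) {0..t/2}"
    using t relaxation_has_derivative
    by (intro fundamental_theorem_of_calculus_interior relaxation_continuous)
       (auto simp: has_real_derivative_iff_has_vector_derivative)
  then have "((\<lambda>s. (t/2) powr - r * ?h' s) has_integral (t/2) powr - r * (h (t/2) - h 0)) {0..t/2}"
    by (rule has_integral_mult_right)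
  moreover have "(t/2) powr - r * ?h' s \<le> ?f s" if "0 < s" "s < t/2" for s
    unfolding caputo_integrand_real using that r relaxation_derivative_nonpos[of s]
    by (intro mult_right_mono_neg powr_mono2') auto
  ultimately have "(t/2) powr - r * (h (t/2) - h 0) \<le> integral {0..t/2} ?f"
    by (rule has_integral_le_interior[OF _ integrable_integral[OF int1]])
  moreover have "(t/2) powr - r * (- 1) \<le> (t/2) powr - r * (h (t/2) - h 0)"
    using relaxation_pos[of "t/2"] t relaxation_init by (intro mult_left_mono) auto
  ultimately have A: "- ((t/2) powr - r) \<le> integral {0..t/2} ?f" by simp
  have "((\<lambda>s. (t - s) powr - r) has_integral (- ((t - t) powr (1 - r) / (1 - r)) - - ((t - t/2) powr (1 - r) / (1 - r)))) {t/2..t}"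
  proof (rule fundamental_theorem_of_calculus_interior)
    show "continuous_on {t/2..t} (\<lambda>s. - ((t - s) powr (1 - r) / (1 - r)))"
      using r by (intro continuous_intros continuous_on_powr') auto
    fix s assume "s \<in> {t/2<..<t}"
    then have "((\<lambda>s. (t - s) powr - (r - 1) / (r - 1)) has_real_derivative
        (r - 1) * (t - s) powr (- (r - 1) - 1) / (r - 1)) (at s)"
      by (intro DERIV_cdivide powr_kernel_derivative) auto
    moreover have "(t - x) powr - (r - 1) / (r - 1) = - ((t - x) powr (1 - r) / (1 - r))" for x
      using r by (simp add: field_simps)
    ultimately show "((\<lambda>s. - ((t - s) powr (1 - r) / (1 - r))) has_vector_derivative (t - s) powr - r) (at s)"
      using r by (simp add: has_real_derivative_iff_has_vector_derivative)
  qed (use t in auto)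
  then have "((\<lambda>s. - (2 / t) * (t - s) powr - r) has_integral - (2 / t) * ((t/2) powr (1 - r) / (1 - r))) {t/2..t}"
    by (intro has_integral_mult_right) simp
  moreover have "- (2 / t) * (t - s) powr - r \<le> ?f s" if "t/2 < s" "s < t" for s
  proof -
    have "1 / s \<le> 2 / t" using that t by (simp add: field_simps)
    then have "- (2 / t) \<le> ?h' s" using relaxation_derivative_bound[of s] that t by auto
    then show ?thesis
      unfolding caputo_integrand_real by (subst mult.commute) (intro mult_left_mono, auto)
  qed
  ultimately have "- (2 / t) * ((t/2) powr (1 - r) / (1 - r)) \<le> integral {t/2..t} ?f"
    by (rule has_integral_le_interior[OF _ integrable_integral[OF int2]])
  moreover have "(2 / t) * (t/2) powr (1 - r) = (t/2) powr - r"
    using powr_add[of "t/2" 1 "- r"] t by (simp add: divide_eq_eq mult_ac)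
  then have "(2 / t) * ((t/2) powr (1 - r) / (1 - r)) = (t/2) powr - r / (1 - r)"
    by (metis times_divide_eq_right)
  ultimately have B: "- ((t/2) powr - r / (1 - r)) \<le> integral {t/2..t} ?f"
    by (simp only: mult_minus_left)
  have "integral {0..t} ?f = integral {0..t/2} ?f + integral {t/2..t} ?f"
    using Henstock_Kurzweil_Integration.integral_combine[OF _ _ int, of "t/2"] t by simp
  with A B show ?thesis by (simp add: r_def distrib_left)
qed

text \<open>
  A decreasing function attains at \<open>t\<close> its minimum over the past, so the maximum principle, applied
  to \<open>- h\<close>, compares \<open>lam * h t\<close> with \<open>kernel t * (1 - h t)\<close>.
\<close>

lemma relaxation_lower_bound:
  assumes t: "t > 0" shows "kernel t \<le> (lam + kernel t) * h t"
proof -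
  have "multi_caputo h t \<le> kernel t * (h t - h 0)"
    using t by (intro multi_caputo_at_minimum[OF relaxation_admissible, of _ "t + 1"] relaxation_antimono) auto
  then show ?thesis using relaxation_equation[OF t] relaxation_init by (simp add: algebra_simps)
qed

lemma relaxation_upper_bound:
  assumes t: "t > 0"
  shows "lam * h t \<le> (\<Sum>j=1..M. q j * ((t/2) powr - \<rho> j * (1 + 1 / (1 - \<rho> j)) / Gamma (1 - \<rho> j)))"
proof -
  have "lam * h t = (\<Sum>j=1..M. q j * - caputo_deriv (\<rho> j) h t)"
    using relaxation_equation[OF t] by (simp add: multi_caputo_def sum_negf)
  also have "\<dots> \<le> (\<Sum>j=1..M. q j * ((t/2) powr - \<rho> j * (1 + 1 / (1 - \<rho> j)) / Gamma (1 - \<rho> j)))"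
  proof (intro sum_mono mult_left_mono)
    fix j assume j: "j \<in> {1..M}"
    show "- caputo_deriv (\<rho> j) h t \<le> (t/2) powr - \<rho> j * (1 + 1 / (1 - \<rho> j)) / Gamma (1 - \<rho> j)"
      using divide_right_mono[OF relaxation_caputo_bound[OF t j], of "Gamma (1 - \<rho> j)"]
        Gamma_real_pos[of "1 - \<rho> j"] order_less_1[OF j] by (simp add: caputo_deriv_def)
    show "0 \<le> q j" using weight_pos[OF j] by simp
  qed
  finally show ?thesis .
qed

end

text \<open>
  The integrand has constant sign, so a partial integral is controlled by the full one.
\<close>

lemma relaxation_partial_integral_bound:
  assumes lam: "lam > 0" and h: "relaxation lam h" and s: "0 \<le> s" "s \<le> t" and t: "t > 0" and j: "j \<in> {1..M}"
  shows "\<bar>integral {0..s} (caputo_integrand (\<rho> j) h t)\<bar> \<le> (t/2) powr - \<rho> j * (1 + 1 / (1 - \<rho> j))"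
proof -
  let ?f = "caputo_integrand (\<rho> j) h t"
  have int: "?f integrable_on {0..t}"
    using relaxation_exists[OF lam h t j] by (simp add: caputo_deriv_exists_def)
  have neg: "integral {a..b} ?f \<le> 0" if "0 \<le> a" "b \<le> t" for a b
  proof -
    have "?f integrable_on {a..b}" using that by (intro integrable_on_subinterval[OF int]) auto
    from has_integral_le_interior[OF integrable_integral[OF this] has_integral_0] show ?thesis
      using relaxation_derivative_nonpos[OF lam h] that by (simp add: caputo_integrand_real mult_nonneg_nonpos)
  qed
  have "integral {0..t} ?f = integral {0..s} ?f + integral {s..t} ?f"
    using Henstock_Kurzweil_Integration.integral_combine[OF s int] by simp
  then show ?thesis
    using neg[of 0 s] neg[of s t] s relaxation_caputo_bound[OF lam h t j] by simp
qed

lemma relaxation_partial_integral_derivative: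
  assumes lam: "lam > 0" and h: "relaxation lam h" and s: "0 < s" "s < t" and j: "j \<in> {1..M}"
  shows "((\<lambda>s. integral {0..s} (caputo_integrand (\<rho> j) h t)) has_real_derivative caputo_integrand (\<rho> j) h t s) (at s)"
proof -
  let ?f = "caputo_integrand (\<rho> j) h t"
  have int: "?f integrable_on {0..t}"
    using relaxation_exists[OF lam h _ j, of t] s by (simp add: caputo_deriv_exists_def)
  have "isCont (\<lambda>t. vector_derivative h (at t)) s"
    using h s by (auto simp: relaxation_def continuous_on_eq_continuous_at)
  then have "isCont ?f s"
    unfolding caputo_integrand_real
    by (intro continuous_mult DERIV_isCont[OF powr_kernel_derivative[OF s(2)]])
  then have "continuous (at s within {0..t} - {}) ?f" by (rule continuous_at_imp_continuous_at_within)
  then have "((\<lambda>s. integral {0..s} ?f) has_vector_derivative ?f s) (at s within {0..t} - {})"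
    by (rule integral_has_vector_derivative_continuous_at[OF int, rotated 2]) (use s in auto)
  moreover have "at s within {0..t} = at s" using s by (intro at_within_interior) auto
  ultimately show ?thesis by (simp add: has_real_derivative_iff_has_vector_derivative)
qed

end

section \<open>Series of fractional powers\<close>

text \<open>
  For \<open>S = exp 1 * R\<close> the part of Euler's integral for \<open>Gamma (y + 1)\<close> beyond \<open>S\<close> is at least
  \<open>S powr y * exp (- S)\<close>. Dividing by \<open>y \<le> exp y\<close> gives the bound for \<open>Gamma y\<close>. Since \<open>R\<close> is
  arbitrary, this replaces Stirling's formula in the convergence of the series below.
\<close>

lemma inverse_Gamma_bound:
  fixes y R :: real
  assumes y: "y > 0" and R: "R > 0"
  shows "1 / Gamma y \<le> exp (exp 1 * R) * R powr - y"
proof -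
  \<comment> \<open>The factor exp 1 absorbs the division by y, as y is at most exp y.\<close>
  define S where "S = exp 1 * R"
  have S: "S > 0" using R by (simp add: S_def)
  have "((\<lambda>s. S powr y * exp (- 1 * s)) has_integral S powr y * (exp (- 1 * S) / 1)) {S..}"
    by (intro has_integral_mult_right has_integral_exp_minus_to_infinity) simp
  then have I: "((\<lambda>s. if s \<in> {S..} then S powr y * exp (- 1 * s) else 0) has_integral S powr y * (exp (- 1 * S) / 1)) {0..}"
    using S by (subst has_integral_restrict) auto
  have "S powr y * (exp (- 1 * S) / 1) \<le> Gamma (y + 1)"
  proof (rule has_integral_le[OF I Gamma_integral_real])
    fix s :: real assume "s \<in> {0..}"
    then show "(if s \<in> {S..} then S powr y * exp (- 1 * s) else 0) \<le> s powr (y + 1 - 1) / exp s"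
      using y S by (auto simp: exp_minus divide_inverse intro!: mult_right_mono powr_mono2)
  qed (use y in simp)
  then have "S powr y * exp (- S) \<le> y * Gamma y"
    using y by (subst (asm) Gamma_plus1) (auto elim!: nonpos_Ints_cases)
  also have "\<dots> \<le> exp y * Gamma y"
    using exp_ge_add_one_self[of y] y Gamma_real_pos[OF y] by (intro mult_right_mono) linarith+
  finally have "exp y * R powr y * exp (- S) \<le> exp y * Gamma y"
    using R by (simp add: S_def powr_mult powr_def[of "exp 1"])
  then have "R powr y * exp (- S) \<le> Gamma y" by simp
  then show ?thesis
    using R Gamma_real_pos[OF y] by (simp add: S_def exp_minus powr_minus field_simps)
qed

text \<open>
  Euler's beta integral, rescaled to \<open>{0..t}\<close>: fractional integration of order \<open>1 - r\<close> maps the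
  normalised power \<open>s powr (g - 1) / Gamma g\<close> to the one with \<open>g + (1 - r)\<close> in place of \<open>g\<close>.
\<close>

lemma has_integral_powr_convolution:
  fixes g r t :: real
  assumes g: "g > 0" and r: "r < 1" and t: "t > 0"
  shows "((\<lambda>s. (t - s) powr - r * (s powr (g - 1) / Gamma g)) has_integral
           Gamma (1 - r) * (t powr (g + 1 - r - 1) / Gamma (g + 1 - r))) {0..t}"
proof -
  have "((\<lambda>x. x powr (g - 1) * (1 - x) powr (1 - r - 1)) has_integral Beta g (1 - r)) {0..1}"
    using g r by (intro has_integral_Beta_real) auto
  from has_integral_stretch_real[OF this, of "1 / t"] t
  have "((\<lambda>s. (s / t) powr (g - 1) * (1 - s / t) powr - r) has_integral t * Beta g (1 - r)) {0..t}"
    using image_mult_atLeastAtMost[of t 0 1] by (simp add: mult.commute[of _ t])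
  then have I: "((\<lambda>s. t powr (g - r - 1) / Gamma g * ((s / t) powr (g - 1) * (1 - s / t) powr - r)) has_integral
      t powr (g - r - 1) / Gamma g * (t * Beta g (1 - r))) {0..t}"
    by (rule has_integral_mult_right)
  have val: "t powr (g - r - 1) / Gamma g * (t * Beta g (1 - r)) =
      Gamma (1 - r) * (t powr (g + 1 - r - 1) / Gamma (g + 1 - r))"
  proof -
    have "t powr (g - r) = t powr (g - r - 1) * t"
      using powr_add[of t "g - r - 1" 1] t by simp
    then show ?thesis
      using Gamma_real_pos[OF g] by (simp add: Beta_def add_diff_eq)
  qed
  have cong: "t powr (g - r - 1) / Gamma g * ((s / t) powr (g - 1) * (1 - s / t) powr - r) =
      (t - s) powr - r * (s powr (g - 1) / Gamma g)" if "s \<in> {0..t}" for s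
  proof -
    have "(1 - s / t) powr - r = (t - s) powr - r / t powr - r"
      using that t by (simp add: powr_divide[symmetric] diff_divide_distrib)
    moreover have "t powr (g - r - 1) = t powr (g - 1) * t powr - r"
      using powr_add[of t "g - 1" "- r"] by (simp add: algebra_simps)
    ultimately show ?thesis using that t by (simp add: powr_divide)
  qed
  show ?thesis using iffD1[OF has_integral_cong[OF cong] I] by (simp only: val)
qed

lemma powr_divide_minus:
  fixes t R b :: real assumes "t \<ge> 0" "R > 0" shows "(t / R) powr b = t powr b * R powr - b"
  using assms by (simp add: powr_divide powr_minus_divide)

text \<open>
  Let \<open>k = (\<Sum>i\<in>I. p i * t powr (\<beta> i - 1) / Gamma (\<beta> i))\<close>. The function \<open>resolvent g\<close> below is the
  Neumann series solution \<open>y\<close> of the Volterra equation \<open>y + k * y = t powr (g - 1) / Gamma g\<close>, with \<open>*\<close>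
  the convolution. Convolution with the \<open>i\<close>-th summand of \<open>k\<close> raises \<open>g\<close> by \<open>\<beta> i\<close>. Keeping \<open>g\<close> as a
  parameter therefore allows the iterated convolutions to be defined by recursion, and their
  derivatives and fractional integrals merely shift \<open>g\<close>.
\<close>

locale power_kernel_resolvent =
  fixes I :: "'i set" and p \<beta> :: "'i \<Rightarrow> real"
  assumes finite_I: "finite I" and exponent_pos: "\<And>i. i \<in> I \<Longrightarrow> \<beta> i > 0"
begin

primrec resolvent_term :: "nat \<Rightarrow> real \<Rightarrow> real \<Rightarrow> real" where
  "resolvent_term 0 g t = t powr (g - 1) / Gamma g"
| "resolvent_term (Suc n) g t = - (\<Sum>i\<in>I. p i * resolvent_term n (g + \<beta> i) t)"

definition resolvent :: "real \<Rightarrow> real \<Rightarrow> real" where "resolvent g t = (\<Sum>n. resolvent_term n g t)"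

lemma resolvent_at_zero: "resolvent g 0 = 0"
proof -
  have "resolvent_term n g 0 = 0" for n g by (induction n arbitrary: g) auto
  then show ?thesis by (simp add: resolvent_def)
qed

text \<open>
  Each step multiplies the bound for the powers by at most \<open>\<Sum>i\<in>I. \<bar>p i\<bar> * (t / R) powr \<beta> i\<close>, which is
  made small by a large \<open>R\<close>. So the series converges geometrically, with a ratio that does not
  depend on \<open>g\<close>.
\<close>

lemma resolvent_term_bound:
  assumes R: "R > 0" and t: "t \<ge> 0" and small: "(\<Sum>i\<in>I. \<bar>p i\<bar> * (t / R) powr \<beta> i) \<le> 1/2"
  shows "g > 0 \<Longrightarrow> \<bar>resolvent_term n g t\<bar> \<le> exp (exp 1 * R) * (t powr (g - 1) * R powr - g) * (1/2)^n"
proof (induction n arbitrary: g)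
  case 0
  then have "\<bar>resolvent_term 0 g t\<bar> = t powr (g - 1) * (1 / Gamma g)"
    using Gamma_real_pos[OF 0] by simp
  also have "\<dots> \<le> t powr (g - 1) * (exp (exp 1 * R) * R powr - g)"
    using 0 R by (intro mult_left_mono inverse_Gamma_bound) auto
  finally show ?case by (simp add: mult_ac)
next
  case (Suc n)
  let ?C = "exp (exp 1 * R) * (t powr (g - 1) * R powr - g) * (1/2)^n"
  have "\<bar>p i * resolvent_term n (g + \<beta> i) t\<bar> \<le> \<bar>p i\<bar> * (t / R) powr \<beta> i * ?C" if i: "i \<in> I" for i
  proof -
    have "t powr (g + \<beta> i - 1) * R powr - (g + \<beta> i) = (t / R) powr \<beta> i * (t powr (g - 1) * R powr - g)"
      using t R powr_add[of t "g - 1" "\<beta> i"] powr_add[of R "- g" "- \<beta> i"]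
      by (simp add: powr_divide_minus add_diff_eq diff_add_eq)
    moreover have "\<bar>resolvent_term n (g + \<beta> i) t\<bar> \<le> exp (exp 1 * R) * (t powr (g + \<beta> i - 1) * R powr - (g + \<beta> i)) * (1/2)^n"
      using Suc.prems exponent_pos[OF i] by (intro Suc.IH) simp
    ultimately have "\<bar>resolvent_term n (g + \<beta> i) t\<bar> \<le> (t / R) powr \<beta> i * ?C" by (simp add: mult_ac)
    from mult_left_mono[OF this, of "\<bar>p i\<bar>"] show ?thesis by (simp add: abs_mult mult_ac)
  qed
  then have "(\<Sum>i\<in>I. \<bar>p i * resolvent_term n (g + \<beta> i) t\<bar>) \<le> (\<Sum>i\<in>I. \<bar>p i\<bar> * (t / R) powr \<beta> i) * ?C"
    unfolding sum_distrib_right by (rule sum_mono)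
  also have "\<dots> \<le> 1/2 * ?C"
    using small by (rule mult_right_mono) simp
  finally have "(\<Sum>i\<in>I. \<bar>p i * resolvent_term n (g + \<beta> i) t\<bar>) \<le> 1/2 * ?C" .
  then have "\<bar>resolvent_term (Suc n) g t\<bar> \<le> 1/2 * ?C"
    by (simp only: resolvent_term.simps abs_minus_cancel) (rule order_trans[OF sum_abs])
  then show ?case by simp
qed

lemma resolvent_term_uniform_bound:
  assumes "T > 0"
  obtains R where "R > 0" "\<And>n g t. g > 0 \<Longrightarrow> 0 \<le> t \<Longrightarrow> t \<le> T \<Longrightarrow>
    \<bar>resolvent_term n g t\<bar> \<le> exp (exp 1 * R) * (t powr (g - 1) * R powr - g) * (1/2)^n"
proof -
  have "((\<lambda>R. \<Sum>i\<in>I. \<bar>p i\<bar> * (T / R) powr \<beta> i) \<longlongrightarrow> (\<Sum>i\<in>I. \<bar>p i\<bar> * 0)) at_top"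
  proof (intro tendsto_sum tendsto_mult tendsto_const)
    fix i assume "i \<in> I"
    have "((\<lambda>R. T powr \<beta> i * R powr - \<beta> i) \<longlongrightarrow> T powr \<beta> i * 0) at_top"
      using exponent_pos[OF \<open>i \<in> I\<close>]
      by (intro tendsto_mult tendsto_const tendsto_neg_powr filterlim_ident) auto
    moreover have "\<forall>\<^sub>F R in at_top. T powr \<beta> i * R powr - \<beta> i = (T / R) powr \<beta> i"
      using eventually_gt_at_top[of 0]
      by eventually_elim (use assms in \<open>simp add: powr_divide_minus\<close>)
    ultimately show "((\<lambda>R. (T / R) powr \<beta> i) \<longlongrightarrow> 0) at_top"
      using tendsto_cong by fastforce
  qed
  then have "\<forall>\<^sub>F R in at_top. (\<Sum>i\<in>I. \<bar>p i\<bar> * (T / R) powr \<beta> i) < 1/2"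
    using order_tendstoD(2)[of _ 0 at_top "1/2 :: real"] by simp
  with eventually_gt_at_top[of 0] have "\<forall>\<^sub>F R in at_top. R > 0 \<and> (\<Sum>i\<in>I. \<bar>p i\<bar> * (T / R) powr \<beta> i) < 1/2"
    by eventually_elim simp
  then obtain R where R: "R > 0" "(\<Sum>i\<in>I. \<bar>p i\<bar> * (T / R) powr \<beta> i) < 1/2"
    by (metis (mono_tags, lifting) eventually_at_top_linorder order_refl)
  show thesis
  proof (rule that[OF R(1)])
    fix n g t assume "(g::real) > 0" "0 \<le> t" "t \<le> T"
    have "(\<Sum>i\<in>I. \<bar>p i\<bar> * (t / R) powr \<beta> i) \<le> (\<Sum>i\<in>I. \<bar>p i\<bar> * (T / R) powr \<beta> i)"
      using \<open>0 \<le> t\<close> \<open>t \<le> T\<close> R(1) exponent_pos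
      by (intro sum_mono mult_left_mono powr_mono2) (auto intro: less_imp_le divide_right_mono)
    with R(2) show "\<bar>resolvent_term n g t\<bar> \<le> exp (exp 1 * R) * (t powr (g - 1) * R powr - g) * (1/2)^n"
      by (intro resolvent_term_bound R(1)) (use \<open>0 \<le> t\<close> \<open>g > 0\<close> in auto)
  qed
qed

lemma summable_half_powers: "summable (\<lambda>n. C * (1/2)^n :: real)"
  by (intro summable_mult summable_geometric) simp

lemma summable_resolvent_term: 
  assumes "g > 0" "t \<ge> 0" shows "summable (\<lambda>n. resolvent_term n g t)"
proof -
  obtain R where "R > 0" and bound: "\<And>n g s. g > 0 \<Longrightarrow> 0 \<le> s \<Longrightarrow> s \<le> t + 1 \<Longrightarrow>
    \<bar>resolvent_term n g s\<bar> \<le> exp (exp 1 * R) * (s powr (g - 1) * R powr - g) * (1/2)^n"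
    using resolvent_term_uniform_bound[of "t + 1"] assms(2) by auto
  show ?thesis
    by (rule summable_comparison_test[OF _ summable_half_powers]) (use bound[OF assms(1,2)] in auto)
qed

lemma resolvent_equation:
  assumes "g > 0" "t \<ge> 0"
  shows "resolvent g t = t powr (g - 1) / Gamma g - (\<Sum>i\<in>I. p i * resolvent (g + \<beta> i) t)"
proof -
  have sm: "summable (\<lambda>n. resolvent_term n (g + \<beta> i) t)" if "i \<in> I" for i
    using exponent_pos[OF that] assms by (intro summable_resolvent_term) auto
  have "resolvent g t = resolvent_term 0 g t + (\<Sum>n. resolvent_term (Suc n) g t)"
    unfolding resolvent_def using suminf_split_head[OF summable_resolvent_term[OF assms]] by simp
  also have "(\<Sum>n. resolvent_term (Suc n) g t) = - (\<Sum>n. \<Sum>i\<in>I. p i * resolvent_term n (g + \<beta> i) t)"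
    using sm by (simp add: suminf_minus summable_sum summable_mult)
  also have "(\<Sum>n. \<Sum>i\<in>I. p i * resolvent_term n (g + \<beta> i) t) = (\<Sum>i\<in>I. \<Sum>n. p i * resolvent_term n (g + \<beta> i) t)"
    using sm by (intro suminf_sum summable_mult)
  also have "\<dots> = (\<Sum>i\<in>I. p i * resolvent (g + \<beta> i) t)"
    unfolding resolvent_def using sm by (intro sum.cong suminf_mult) auto
  finally show ?thesis by simp
qed

lemma uniform_limit_resolvent:
  assumes g: "g > 0" and X: "X \<subseteq> {0..T}" "\<And>x. x \<in> X \<Longrightarrow> x powr (g - 1) \<le> K"
  shows "uniform_limit X (\<lambda>n x. \<Sum>i<n. resolvent_term i g x) (resolvent g) sequentially"
proof -
  obtain R where "R > 0" and bound: "\<And>n g s. g > 0 \<Longrightarrow> 0 \<le> s \<Longrightarrow> s \<le> max T 1 \<Longrightarrow>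
    \<bar>resolvent_term n g s\<bar> \<le> exp (exp 1 * R) * (s powr (g - 1) * R powr - g) * (1/2)^n"
    by (rule resolvent_term_uniform_bound[of "max T 1"]) auto
  show ?thesis unfolding resolvent_def
  proof (rule Weierstrass_m_test[OF _ summable_half_powers])
    fix n x assume x: "x \<in> X"
    have "\<bar>resolvent_term n g x\<bar> \<le> exp (exp 1 * R) * (x powr (g - 1) * R powr - g) * (1/2)^n"
      using X(1) x by (intro bound g) (auto simp: max.coboundedI1 subset_iff)
    also have "\<dots> \<le> exp (exp 1 * R) * (K * R powr - g) * (1/2)^n"
      using X(2)[OF x] by (intro mult_right_mono mult_left_mono) auto
    finally show "norm (resolvent_term n g x) \<le> exp (exp 1 * R) * (K * R powr - g) * (1/2)^n" by simp
  qed
qed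

lemma continuous_on_resolvent_term:
  assumes X: "X \<subseteq> {0..}" 
  shows "(0 \<notin> X \<or> g > 1) \<Longrightarrow> g > 0 \<Longrightarrow> continuous_on X (resolvent_term n g)"
proof (induction n arbitrary: g)
  case 0
  have "continuous_on X (\<lambda>t. t powr (g - 1))"
    by (rule continuous_on_powr'[OF continuous_on_id continuous_on_const]) (use 0 X in auto)
  then have "continuous_on X (\<lambda>t. t powr (g - 1) / Gamma g)"
    using Gamma_real_pos[OF 0(2)] by (intro continuous_on_divide continuous_on_const) auto
  then show ?case by (simp cong: continuous_on_cong)
next
  case (Suc n)
  have "continuous_on X (\<lambda>t. - (\<Sum>i\<in>I. p i * resolvent_term n (g + \<beta> i) t))"
    using Suc.prems exponent_pos by (intro continuous_intros Suc.IH) fastforce+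
  then show ?case by (simp cong: continuous_on_cong)
qed

lemma continuous_on_resolvent:
  assumes "g > 0" "X \<subseteq> {0..T}" "0 \<notin> X \<or> g > 1" "\<And>x. x \<in> X \<Longrightarrow> x powr (g - 1) \<le> K"
  shows "continuous_on X (resolvent g)"
  by (rule uniform_limit_theorem[OF _ uniform_limit_resolvent[OF assms(1,2,4)]])
     (use assms in \<open>auto intro!: always_eventually continuous_intros continuous_on_resolvent_term\<close>)

text \<open>
  A bound that holds for exponents of either sign.
\<close>

lemma powr_le_endpoints:
  fixes x a b e :: real
  assumes "0 < a" "a \<le> x" "x \<le> b" shows "x powr e \<le> a powr e + b powr e"
proof (cases "e \<ge> 0")
  case True
  then have "x powr e \<le> b powr e" using assms by (intro powr_mono2) auto
  then show ?thesis using powr_ge_zero[of a e] by linarith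
next
  case False
  then have "x powr e \<le> a powr e" using assms by (intro powr_mono2') auto
  then show ?thesis using powr_ge_zero[of b e] by linarith
qed

lemma continuous_on_resolvent_pos: "g > 0 \<Longrightarrow> 0 < a \<Longrightarrow> continuous_on {a..b} (resolvent g)"
  by (rule continuous_on_resolvent[where T = b and K = "a powr (g - 1) + b powr (g - 1)"])
     (auto intro: powr_le_endpoints)

lemma continuous_on_resolvent_zero: "g > 1 \<Longrightarrow> continuous_on {0..b} (resolvent g)"
  by (rule continuous_on_resolvent[where T = b and K = "b powr (g - 1)"])
     (auto intro: powr_mono2)

lemma resolvent_term_has_derivative:
  assumes t: "t > 0"
  shows "g > 0 \<Longrightarrow> (resolvent_term n (g + 1) has_real_derivative resolvent_term n g t) (at t)"
proof (induction n arbitrary: g)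
  case 0
  have "((\<lambda>t. t powr g / Gamma (g + 1)) has_real_derivative (g * t powr (g - 1)) / Gamma (g + 1)) (at t)"
    using t by (intro DERIV_cdivide has_real_derivative_powr)
  moreover have "Gamma (g + 1) = g * Gamma g"
    using 0 by (intro Gamma_plus1) (auto elim!: nonpos_Ints_cases)
  moreover have "resolvent_term 0 (g + 1) = (\<lambda>t. t powr g / Gamma (g + 1))" by (simp add: fun_eq_iff)
  ultimately show ?case using 0 by simp
next
  case (Suc n)
  have "((\<lambda>t. - (\<Sum>i\<in>I. p i * resolvent_term n (g + \<beta> i + 1) t)) has_real_derivative
      - (\<Sum>i\<in>I. p i * resolvent_term n (g + \<beta> i) t)) (at t)"
    using Suc.prems exponent_pos by (intro DERIV_minus DERIV_sum DERIV_cmult Suc.IH) fastforce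
  moreover have "resolvent_term (Suc n) (g + 1) = (\<lambda>t. - (\<Sum>i\<in>I. p i * resolvent_term n (g + \<beta> i + 1) t))"
    by (simp add: fun_eq_iff add_ac)
  ultimately show ?case by simp
qed

lemma resolvent_has_derivative:
  assumes g: "g > 0" and t: "t > 0"
  shows "(resolvent (g + 1) has_real_derivative resolvent g t) (at t)"
proof -
  let ?X = "{t/2..2 * t}"
  have "((\<lambda>x. \<Sum>n. resolvent_term n (g + 1) x) has_real_derivative (\<Sum>n. resolvent_term n g t)) (at t)"
  proof (rule has_field_derivative_series'(2)[of ?X])
    show "(resolvent_term n (g + 1) has_real_derivative resolvent_term n g x) (at x within ?X)" if "x \<in> ?X" for n x
      by (rule has_field_derivative_at_within, rule resolvent_term_has_derivative) (use that t g in auto)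
    have "uniform_limit ?X (\<lambda>n x. \<Sum>i<n. resolvent_term i g x) (resolvent g) sequentially"
      by (rule uniform_limit_resolvent[OF g, where T = "2 * t" and K = "(t/2) powr (g - 1) + (2 * t) powr (g - 1)"])
         (use t in \<open>auto intro: powr_le_endpoints\<close>)
    then show "uniformly_convergent_on ?X (\<lambda>n x. \<Sum>i<n. resolvent_term i g x)"
      unfolding uniformly_convergent_on_def by blast
    show "summable (\<lambda>n. resolvent_term n (g + 1) t)" using g t by (intro summable_resolvent_term) auto
  qed (use t in auto)
  then show ?thesis by (simp add: resolvent_def[abs_def])
qed

lemma resolvent_term_has_fractional_integral:
  assumes t: "t > 0" and r: "r < 1"
  shows "g > 0 \<Longrightarrow> ((\<lambda>s. (t - s) powr - r * resolvent_term n g s) has_integral Gamma (1 - r) * resolvent_term n (g + 1 - r) t) {0..t}"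
proof (induction n arbitrary: g)
  case 0
  then show ?case using has_integral_powr_convolution[OF 0 r t] by simp
next
  case (Suc n)
  have "((\<lambda>s. - (\<Sum>i\<in>I. p i * ((t - s) powr - r * resolvent_term n (g + \<beta> i) s))) has_integral
      - (\<Sum>i\<in>I. p i * (Gamma (1 - r) * resolvent_term n (g + \<beta> i + 1 - r) t))) {0..t}"
    using Suc.prems exponent_pos finite_I
    by (intro has_integral_neg has_integral_sum has_integral_mult_right Suc.IH) (fastforce)+
  moreover have "- (\<Sum>i\<in>I. p i * (Gamma (1 - r) * resolvent_term n (g + \<beta> i + 1 - r) t)) = Gamma (1 - r) * resolvent_term (Suc n) (g + 1 - r) t"
    by (simp add: sum_distrib_left algebra_simps)
  moreover have "(\<lambda>s. - (\<Sum>i\<in>I. p i * ((t - s) powr - r * resolvent_term n (g + \<beta> i) s))) = (\<lambda>s. (t - s) powr - r * resolvent_term (Suc n) g s)"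
    by (simp add: sum_distrib_left algebra_simps)
  ultimately show ?case by simp
qed

lemma resolvent_has_fractional_integral:
  assumes t: "t > 0" and r: "r < 1" and g: "g > 0"
  shows "((\<lambda>s. (t - s) powr - r * resolvent g s) has_integral Gamma (1 - r) * resolvent (g + 1 - r) t) {0..t}"
proof -
  obtain R where "R > 0" and bound: "\<And>n g s. g > 0 \<Longrightarrow> 0 \<le> s \<Longrightarrow> s \<le> t \<Longrightarrow>
    \<bar>resolvent_term n g s\<bar> \<le> exp (exp 1 * R) * (s powr (g - 1) * R powr - g) * (1/2)^n"
    using resolvent_term_uniform_bound[OF t] by metis
  define C where "C = exp (exp 1 * R) * R powr - g"
  have "((\<lambda>s. (t - s) powr - r * (s powr (g - 1) / Gamma g)) has_integral
           Gamma (1 - r) * (t powr (g + 1 - r - 1) / Gamma (g + 1 - r))) {0..t}"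
    by (rule has_integral_powr_convolution) fact+
  from has_integral_mult_right[OF this, of "2 * C * Gamma g"]
  \<comment> \<open>The factor 2 is the sum of the geometric series with ratio 1/2.\<close>
  have dom: "(\<lambda>s. (t - s) powr - r * (2 * C * s powr (g - 1))) integrable_on {0..t}"
    using Gamma_real_pos[OF g] by (auto simp: integrable_on_def mult_ac)
  show ?thesis
  proof (rule has_integral_dominated_convergence[OF _ dom])
    show "((\<lambda>s. (t - s) powr - r * (\<Sum>n<k. resolvent_term n g s)) has_integral (\<Sum>n<k. Gamma (1 - r) * resolvent_term n (g + 1 - r) t)) {0..t}" for k
      unfolding sum_distrib_left by (intro has_integral_sum resolvent_term_has_fractional_integral t r g) auto
    show "\<forall>s\<in>{0..t}. norm ((t - s) powr - r * (\<Sum>n<k. resolvent_term n g s)) \<le> (t - s) powr - r * (2 * C * s powr (g - 1))" for k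
    proof
      fix s assume s: "s \<in> {0..t}"
      have "\<bar>\<Sum>n<k. resolvent_term n g s\<bar> \<le> (\<Sum>n<k. C * s powr (g - 1) * (1/2)^n)"
        using bound[OF g, of s] s by (intro order_trans[OF sum_abs] sum_mono) (auto simp: C_def mult_ac)
      also have "\<dots> \<le> (\<Sum>n. C * s powr (g - 1) * (1/2)^n)"
        by (intro sum_le_suminf summable_half_powers) (auto simp: C_def)
      also have "\<dots> = C * s powr (g - 1) * 2"
        by (subst suminf_mult) (simp_all add: suminf_geometric summable_geometric)
      finally have "(t - s) powr - r * \<bar>\<Sum>n<k. resolvent_term n g s\<bar> \<le> (t - s) powr - r * (C * s powr (g - 1) * 2)"
        by (rule mult_left_mono) simp
      then show "norm ((t - s) powr - r * (\<Sum>n<k. resolvent_term n g s)) \<le> (t - s) powr - r * (2 * C * s powr (g - 1))"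
        by (simp add: abs_mult mult_ac)
    qed
    show "\<forall>s\<in>{0..t}. (\<lambda>k. (t - s) powr - r * (\<Sum>n<k. resolvent_term n g s)) \<longlonglongrightarrow> (t - s) powr - r * resolvent g s"
      unfolding resolvent_def using g by (auto intro!: tendsto_mult tendsto_const summable_LIMSEQ summable_resolvent_term)
    show "(\<lambda>k. \<Sum>n<k. Gamma (1 - r) * resolvent_term n (g + 1 - r) t) \<longlonglongrightarrow> Gamma (1 - r) * resolvent (g + 1 - r) t"
      unfolding resolvent_def sum_distrib_left[symmetric] using g r t
      by (intro tendsto_mult tendsto_const summable_LIMSEQ summable_resolvent_term) auto
  qed
qed

end

section \<open>Existence of the relaxation functions\<close>

text \<open>
  The first term is the leading one. Integrating the equation to the order \<open>\<rho> 1\<close> turns the other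
  derivatives into fractional integrals of the positive orders \<open>\<rho> 1 - \<rho> j\<close>.
\<close>

locale ordered_fractional_orders = fractional_orders +
  assumes first_weight: "q 1 = 1"
    and first_order: "j \<in> {2..M} \<Longrightarrow> \<rho> j < \<rho> 1"
begin

text \<open>
  Put \<open>\<beta> 1 = \<rho> 1\<close>, \<open>p 1 = lam\<close>, and \<open>\<beta> i = \<rho> 1 - \<rho> i\<close>, \<open>p i = q i\<close> for the other indices. The solution
  is \<open>1 - lam * resolvent (\<rho> 1 + 1)\<close>: its Caputo derivative of order \<open>\<rho> j\<close> is
  \<open>- lam * resolvent (\<rho> 1 + 1 - \<rho> j)\<close>, and the relaxation equation becomes the resolvent equation for
  the parameter 1, whose inhomogeneity is the constant 1.
\<close>

theorem relaxation_function:
  assumes lam: "lam > 0"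
  shows "\<exists>h. relaxation lam h"
proof -
  define p where "p i = (if i = 1 then lam else q i)" for i
  define \<beta> where "\<beta> i = (if i = 1 then \<rho> 1 else \<rho> 1 - \<rho> i)" for i
  interpret power_kernel_resolvent "{1..M}" p \<beta>
    by standard (use first_order order_pos in \<open>auto simp: \<beta>_def\<close>)
  have one: "1 \<in> {1..M}" using M by simp
  note rho1 = order_pos[OF one] order_less_1[OF one]
  define h where "h t = 1 - lam * resolvent (\<rho> 1 + 1) t" for t
  have der: "(h has_real_derivative - lam * resolvent (\<rho> 1) t) (at t)" if "t > 0" for t
    unfolding h_def using resolvent_has_derivative[OF rho1(1) that] by (auto intro!: derivative_eq_intros)
  then have vd: "vector_derivative h (at t) = - lam * resolvent (\<rho> 1) t" if "t > 0" for t
    using that by (simp add: vector_derivative_at has_real_derivative_iff_has_vector_derivative)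
  have cap: "(caputo_integrand (\<rho> j) h t has_integral - lam * (Gamma (1 - \<rho> j) * resolvent (\<rho> 1 + 1 - \<rho> j) t)) {0..t}"
    if "t > 0" "j \<in> {1..M}" for t j
  proof -
    have "((\<lambda>s. - lam * ((t - s) powr - \<rho> j * resolvent (\<rho> 1) s)) has_integral - lam * (Gamma (1 - \<rho> j) * resolvent (\<rho> 1 + 1 - \<rho> j) t)) {0..t}"
      by (intro has_integral_mult_right resolvent_has_fractional_integral that order_less_1 rho1)
    then show ?thesis
      by (rule has_integral_spike_finite[of "{0}", rotated 2]) (auto simp: caputo_integrand_real vd)
  qed
  have ex: "caputo_deriv_exists (\<rho> j) h t" if "t > 0" "j \<in> {1..M}" for t j
    using cap[OF that] differentiableI_vector[OF der[unfolded has_real_derivative_iff_has_vector_derivative]]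
    by (auto simp: caputo_deriv_exists_def has_integral_integrable)
  have val: "caputo_deriv (\<rho> j) h t = - lam * resolvent (\<rho> 1 + 1 - \<rho> j) t" if "t > 0" "j \<in> {1..M}" for t j
  proof -
    have "Gamma (1 - \<rho> j) \<noteq> 0"
      using Gamma_real_pos[of "1 - \<rho> j"] order_less_1[OF that(2)] by linarith
    then show ?thesis using cap[OF that] by (simp add: caputo_deriv_def integral_unique)
  qed
  \<comment> \<open>The term of index 1 is resolvent 1; expanding it by the resolvent equation cancels the others.\<close>
  have split: "{1..M} = insert 1 {2..M}" using M by auto
  have eq: "multi_caputo h t + lam * h t = 0" if t: "t > 0" for t
  proof -
    have "resolvent 1 t = 1 - (\<Sum>i=1..M. p i * resolvent (1 + \<beta> i) t)"
      using resolvent_equation[of 1 t] t by simp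
    also have "(\<Sum>i=1..M. p i * resolvent (1 + \<beta> i) t) = lam * resolvent (\<rho> 1 + 1) t + (\<Sum>i=2..M. q i * resolvent (\<rho> 1 + 1 - \<rho> i) t)"
    proof -
      have "(\<Sum>i=2..M. p i * resolvent (1 + \<beta> i) t) = (\<Sum>i=2..M. q i * resolvent (\<rho> 1 + 1 - \<rho> i) t)"
        by (intro sum.cong) (auto simp: p_def \<beta>_def add_diff_eq add.commute)
      then show ?thesis unfolding split by (simp add: p_def \<beta>_def add.commute)
    qed
    finally have "resolvent 1 t + (\<Sum>i=2..M. q i * resolvent (\<rho> 1 + 1 - \<rho> i) t) = h t" by (simp add: h_def)
    moreover have "multi_caputo h t = (\<Sum>j=1..M. - lam * (q j * resolvent (\<rho> 1 + 1 - \<rho> j) t))"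
      unfolding multi_caputo_def using val[OF t] by (intro sum.cong) auto
    then have "multi_caputo h t = - lam * (resolvent 1 t + (\<Sum>i=2..M. q i * resolvent (\<rho> 1 + 1 - \<rho> i) t))"
      unfolding sum_distrib_left[symmetric] split using first_weight by simp
    ultimately show ?thesis by simp
  qed
  have "h 0 = 1" unfolding h_def resolvent_at_zero by simp
  moreover have "continuous_on {0..<\<tau>} h" for \<tau>
    by (rule continuous_on_subset[of "{0..\<tau>}"])
       (unfold h_def, intro continuous_intros continuous_on_resolvent_zero, use rho1 in auto)
  moreover have "continuous_on {0<..} (\<lambda>t. vector_derivative h (at t))"
  proof -
    have "isCont (resolvent (\<rho> 1)) t" if "t > 0" for t
      using that rho1 by (intro continuous_on_interior[OF continuous_on_resolvent_pos[of "\<rho> 1" "t/2" "2 * t"]]) auto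
    then have "continuous_on {0<..} (\<lambda>t. - lam * resolvent (\<rho> 1) t)"
      by (intro continuous_intros continuous_at_imp_continuous_on) auto
    then show ?thesis by (rule continuous_on_eq) (simp add: vd)
  qed
  ultimately have "relaxation lam h"
    using ex eq by (simp add: relaxation_def solves_def admissible_def)
  then show ?thesis by blast
qed

definition relax :: "real \<Rightarrow> real \<Rightarrow> real" where "relax lam = (SOME h. relaxation lam h)"

lemma relaxation_relax: "lam > 0 \<Longrightarrow> relaxation lam (relax lam)"
  unfolding relax_def by (rule someI_ex[OF relaxation_function])

end

section \<open>The evolution equation and the backward problem\<close>

locale fractional_evolution = ordered_fractional_orders M \<rho> q + operator_eigenbasis B D A lam l0
  for M \<rho> q and B :: "'h::{real_inner,complete_space} set" and D A lam l0 +
  fixes T :: real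
  assumes T_pos: "T > 0"
begin

lemma lam_pos: "b \<in> B \<Longrightarrow> lam b > 0"
  using lam_ge l0_pos by force

lemma relaxation_mode: "b \<in> B \<Longrightarrow> relaxation (lam b) (relax (lam b))"
  by (intro relaxation_relax lam_pos)

lemma mode_abs_le_1: "b \<in> B \<Longrightarrow> t \<ge> 0 \<Longrightarrow> \<bar>relax (lam b) t\<bar> \<le> 1"
  using relaxation_pos[OF lam_pos relaxation_mode] relaxation_le_1[OF lam_pos relaxation_mode]
  by (smt (verit))

text \<open>
  The coefficient at \<open>b\<close> solves the relaxation equation, so it is a multiple of the relaxation
  function by uniqueness. This holds before the final time, and at the final time by continuity.
\<close>

lemma solution_coefficient:
  assumes u: "backward_solution D A M \<rho> q T \<Phi> u" and b: "b \<in> B" and t: "0 \<le> t" "t \<le> T"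
  shows "u t \<bullet> b = (u 0 \<bullet> b) * relax (lam b) t"
proof -
  let ?v = "\<lambda>s. u s \<bullet> b" and ?e = "\<lambda>s. (u 0 \<bullet> b) * relax (lam b) s + 0 * relax (lam b) s + 0"
  note E = relaxation_admissible[OF lam_pos[OF b] relaxation_mode[OF b]]
    and E_eq = relaxation_equation[OF lam_pos[OF b] relaxation_mode[OF b]]
  have contu: "continuous_on {0..T} u" using u by (simp add: backward_solution_def)
  then have contv: "continuous_on {0..T} ?v" by (intro continuous_intros)
  have at: "u s \<in> D" "\<And>j. j \<in> {1..M} \<Longrightarrow> caputo_deriv_exists (\<rho> j) u s"
    "(\<Sum>j=1..M. q j *\<^sub>R caputo_deriv (\<rho> j) u s) + A (u s) = 0" if "0 < s" "s < T" for s
    using u that by (auto simp: backward_solution_def)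
  have "solves T (lam b) ?v"
    unfolding solves_def admissible_def
  proof (intro conjI ballI)
    show "continuous_on {0..<T} ?v" using contv by (rule continuous_on_subset) auto
    show "caputo_deriv_exists (\<rho> j) ?v s" if "s \<in> {0<..<T}" "j \<in> {1..M}" for s j
      using that at(2)[of s j] by (intro caputo_deriv_inner(1)) auto
    fix s assume s: "s \<in> {0<..<T}"
    have "multi_caputo ?v s = (\<Sum>j=1..M. q j *\<^sub>R caputo_deriv (\<rho> j) u s) \<bullet> b"
      unfolding multi_caputo_def inner_sum_left
      using s at(2)[of s] by (intro sum.cong) (auto simp: caputo_deriv_inner(2))
    also have "(\<Sum>j=1..M. q j *\<^sub>R caputo_deriv (\<rho> j) u s) = - A (u s)"
      using at(3)[of s] s by (simp add: eq_neg_iff_add_eq_0)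
    finally show "multi_caputo ?v s + lam b * ?v s = 0"
      using A_coefficient[OF at(1) b, of s] s by simp
  qed
  moreover have "solves T (lam b) ?e"
    unfolding solves_def
  proof (intro conjI ballI)
    fix s assume s: "s \<in> {0<..<T}"
    show "multi_caputo ?e s + lam b * ?e s = 0"
      using s by (subst multi_caputo_linear_combination[OF E E]) (auto simp: E_eq)
  qed (rule admissible_linear_combination[OF E E])
  moreover have "?v 0 = ?e 0" by (simp add: relaxation_init[OF lam_pos[OF b] relaxation_mode[OF b]])
  ultimately have inner: "?v s = ?e s" if "0 \<le> s" "s < T" for s
    using solution_unique[OF _ _ lam_pos[OF b]] that by blast
  have "?v t - ?e t = 0"
  proof (rule continuous_constant_on_closure[where S = "{0..<T}" and f = "\<lambda>s. ?v s - ?e s"])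
    show "continuous_on (closure {0..<T}) (\<lambda>t. ?v t - ?e t)"
      using T_pos contv relaxation_continuous[OF lam_pos[OF b] relaxation_mode[OF b], of T]
      by (auto intro!: continuous_intros)
    show "t \<in> closure {0..<T}" using t T_pos by simp
    show "?v s - ?e s = 0" if "s \<in> {0..<T}" for s using inner[of s] that by simp
  qed
  then show ?thesis by simp
qed

text \<open>
  The estimate that makes the backward problem well posed. The lower bound
  \<open>lam * kernel T / (lam + kernel T)\<close> increases with \<open>lam\<close>, so its value at \<open>l0\<close> serves all modes.
\<close>

lemma mode_bounds:
  obtains C1 C2 where "C1 > 0" "C2 > 0" "\<And>b. b \<in> B \<Longrightarrow> C1 \<le> lam b * relax (lam b) T"
    "\<And>b. b \<in> B \<Longrightarrow> lam b * relax (lam b) T \<le> C2"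
proof -
  let ?C1 = "l0 * kernel T / (l0 + kernel T)"
  let ?C2 = "\<Sum>j=1..M. q j * ((T/2) powr - \<rho> j * (1 + 1 / (1 - \<rho> j)) / Gamma (1 - \<rho> j))"
  have k: "kernel T > 0" by (rule kernel_pos[OF T_pos])
  show thesis
  proof (rule that[of ?C1 "max ?C2 1"])
    show "?C1 > 0" using l0_pos k by simp
    fix b assume b: "b \<in> B"
    note lb = lam_pos[OF b]
    have "kernel T / (lam b + kernel T) \<le> relax (lam b) T"
      using relaxation_lower_bound[OF lb relaxation_mode[OF b] T_pos] lb k
      by (simp add: pos_divide_le_eq mult.commute)
    then have "lam b * (kernel T / (lam b + kernel T)) \<le> lam b * relax (lam b) T"
      using lb by (intro mult_left_mono) auto
    moreover have "?C1 \<le> lam b * (kernel T / (lam b + kernel T))"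
    proof -
      have "l0 * kernel T * (lam b + kernel T) \<le> lam b * kernel T * (l0 + kernel T)"
        using mult_right_mono[OF lam_ge[OF b], of "kernel T * kernel T"] k by (simp add: algebra_simps)
      then show ?thesis using l0_pos lb k by (simp add: divide_simps mult_ac)
    qed
    ultimately show "?C1 \<le> lam b * relax (lam b) T" by linarith
    show "lam b * relax (lam b) T \<le> max ?C2 1"
      using relaxation_upper_bound[OF lb relaxation_mode[OF b] T_pos] by simp
  qed simp
qed

lemma norm_le_if_coefficients_le:
  assumes "C \<ge> 0" "\<And>b. b \<in> B \<Longrightarrow> \<bar>y \<bullet> b\<bar> \<le> C * \<bar>x \<bullet> b\<bar>"
  shows "norm y \<le> C * norm x"
proof -
  have "(norm y)\<^sup>2 = infsum (\<lambda>b. (y \<bullet> b)\<^sup>2) B" by (rule parseval)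
  also have "\<dots> \<le> infsum (\<lambda>b. C\<^sup>2 * (x \<bullet> b)\<^sup>2) B"
  proof (rule infsum_mono)
    show "(y \<bullet> b)\<^sup>2 \<le> C\<^sup>2 * (x \<bullet> b)\<^sup>2" if "b \<in> B" for b
      using power_mono[OF assms(2)[OF that], of 2] by (simp add: power_mult_distrib)
  qed (intro summable_coefficients summable_on_cmult_right)+
  also have "\<dots> = (C * norm x)\<^sup>2"
    by (simp add: infsum_cmult_right' parseval power_mult_distrib)
  finally show ?thesis using assms(1) by (simp add: power2_le_iff_abs_le)
qed

definition evolution :: "'h \<Rightarrow> real \<Rightarrow> 'h" where
  "evolution x t = diag (\<lambda>b. relax (lam b) t) x"

lemma evolution_inner: "b \<in> B \<Longrightarrow> t \<ge> 0 \<Longrightarrow> evolution x t \<bullet> b = relax (lam b) t * (x \<bullet> b)"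
  unfolding evolution_def by (rule diag_inner[where C = 1]) (rule mode_abs_le_1)

lemma evolution_continuous: "continuous_on {0..T} (evolution x)"
  unfolding evolution_def[abs_def]
  by (rule continuous_on_diag[where C = 1])
     (auto intro: mode_abs_le_1 relaxation_continuous[OF lam_pos relaxation_mode])

lemma mode_derivative_bound:
  "b \<in> B \<Longrightarrow> t > 0 \<Longrightarrow> \<bar>vector_derivative (relax (lam b)) (at t)\<bar> \<le> 1 / t"
  by (rule relaxation_derivative_bound[OF lam_pos relaxation_mode])

lemma evolution_has_derivative:
  assumes t: "t > 0"
  shows "(evolution x has_vector_derivative diag (\<lambda>b. vector_derivative (relax (lam b)) (at t)) x) (at t)"
  unfolding evolution_def[abs_def]
proof (rule diag_has_vector_derivative[where S = "{t/2<..}" and C = 1 and C' = "2 / t"])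
  fix s b assume s: "s \<in> {t/2<..}" and b: "b \<in> B"
  then show "\<bar>relax (lam b) s\<bar> \<le> 1" using t by (intro mode_abs_le_1) auto
  show "((\<lambda>s. relax (lam b) s) has_real_derivative vector_derivative (relax (lam b)) (at s)) (at s)"
    using s t by (intro relaxation_has_derivative[OF lam_pos[OF b] relaxation_mode[OF b]]) auto
  have "1 / s \<le> 2 / t" using s t by (simp add: field_simps)
  then show "\<bar>vector_derivative (relax (lam b)) (at s)\<bar> \<le> 2 / t"
    using mode_derivative_bound[OF b, of s] s t by auto
qed (use t in auto)

lemma evolution_in_domain:
  assumes t: "t > 0"
  shows "evolution x t \<in> D" and "b \<in> B \<Longrightarrow> A (evolution x t) \<bullet> b = lam b * (relax (lam b) t * (x \<bullet> b))"
proof -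
  let ?C = "\<Sum>j=1..M. q j * ((t/2) powr - \<rho> j * (1 + 1 / (1 - \<rho> j)) / Gamma (1 - \<rho> j))"
  have bound: "\<bar>lam b * relax (lam b) t\<bar> \<le> ?C" if b: "b \<in> B" for b
    using relaxation_upper_bound[OF lam_pos[OF b] relaxation_mode[OF b] t]
      relaxation_pos[OF lam_pos[OF b] relaxation_mode[OF b], of t] lam_pos[OF b] t
    by (simp add: abs_mult)
  have "diag (\<lambda>b. lam b * relax (lam b) t) x \<bullet> b = lam b * relax (lam b) t * (x \<bullet> b)" if "b \<in> B" for b
    by (rule diag_inner[OF bound that])
  then have "evolution x t \<in> D \<and> A (evolution x t) = diag (\<lambda>b. lam b * relax (lam b) t) x"
    using t by (intro in_domain) (simp add: evolution_inner)
  then show "evolution x t \<in> D" and "b \<in> B \<Longrightarrow> A (evolution x t) \<bullet> b = lam b * (relax (lam b) t * (x \<bullet> b))"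
    using A_coefficient[of "evolution x t" b] t by (auto simp: evolution_inner)
qed

text \<open>
  The derivative of the evolution may grow like \<open>1 / t\<close> at 0, so that the Caputo integral is improper
  there. It is evaluated through an antiderivative: the diagonal operator whose multipliers are
  the partial Caputo integrals of the modes. By \<open>relaxation_partial_integral_bound\<close> these are bounded
  uniformly up to both endpoints, hence the antiderivative is continuous on \<open>{0..t}\<close> and the
  fundamental theorem of calculus applies.
\<close>

lemma evolution_caputo:
  assumes t: "t > 0" and j: "j \<in> {1..M}"
  shows "caputo_deriv_exists (\<rho> j) (evolution x) t"
    and "b \<in> B \<Longrightarrow> caputo_deriv (\<rho> j) (evolution x) t \<bullet> b = caputo_deriv (\<rho> j) (relax (lam b)) t * (x \<bullet> b)"
proof -
  let ?f = "\<lambda>s b. caputo_integrand (\<rho> j) (relax (lam b)) t s"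
  let ?g = "\<lambda>s b. integral {0..s} (caputo_integrand (\<rho> j) (relax (lam b)) t)"
  let ?K = "(t/2) powr - \<rho> j * (1 + 1 / (1 - \<rho> j))"
  have g_bound: "\<bar>?g s b\<bar> \<le> ?K" if "b \<in> B" "0 \<le> s" "s \<le> t" for s b
    using that t j by (intro relaxation_partial_integral_bound[OF lam_pos relaxation_mode]) auto
  have g_inner: "diag (?g s) x \<bullet> b = ?g s b * (x \<bullet> b)" if "b \<in> B" "0 \<le> s" "s \<le> t" for s b
    by (rule diag_inner[OF g_bound]) (use that in auto)
  have E_int: "caputo_integrand (\<rho> j) (relax (lam b)) t integrable_on {0..t}" if "b \<in> B" for b
    using relaxation_exists[OF lam_pos[OF that] relaxation_mode[OF that] t j] by (simp add: caputo_deriv_exists_def)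
  have g_cont: "continuous_on {0..t} (\<lambda>s. diag (?g s) x)"
    by (rule continuous_on_diag[where C = ?K])
       (auto intro: g_bound indefinite_integral_continuous_1[OF E_int])
  have g_deriv: "((\<lambda>s. diag (?g s) x) has_vector_derivative caputo_integrand (\<rho> j) (evolution x) t s) (at s)"
    if s: "0 < s" "s < t" for s
  proof -
    let ?C' = "((t - s) / 2) powr - \<rho> j * (2 / s)"
    have f_bound: "\<bar>?f r b\<bar> \<le> ?C'" if r: "r \<in> {s/2<..<(s + t)/2}" and b: "b \<in> B" for r b
    proof -
      have "(t - r) powr - \<rho> j \<le> ((t - s) / 2) powr - \<rho> j"
        using r s order_pos[OF j] by (intro powr_mono2') (auto simp: field_simps)
      moreover have "1 / r \<le> 2 / s" using r s by (simp add: field_simps)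
      then have "\<bar>vector_derivative (relax (lam b)) (at r)\<bar> \<le> 2 / s"
        using mode_derivative_bound[OF b, of r] r s by auto
      ultimately show ?thesis
        unfolding caputo_integrand_real abs_mult by (intro mult_mono) auto
    qed
    have "((\<lambda>s. diag (?g s) x) has_vector_derivative diag (?f s) x) (at s)"
    proof (rule diag_has_vector_derivative[where S = "{s/2<..<(s + t)/2}" and C = ?K and C' = ?C'])
      fix r b assume "r \<in> {s/2<..<(s + t)/2}" and b: "b \<in> B"
      then show "((\<lambda>s. ?g s b) has_real_derivative ?f r b) (at r)"
        using s by (intro relaxation_partial_integral_derivative[OF lam_pos[OF b] relaxation_mode[OF b] _ _ j]) auto
    qed (use s g_bound f_bound in auto)
    moreover have "diag (?f s) x = caputo_integrand (\<rho> j) (evolution x) t s"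
    proof (rule eq_if_coefficients_eq)
      fix b assume b: "b \<in> B"
      have "diag (?f s) x \<bullet> b = ?f s b * (x \<bullet> b)"
        by (rule diag_inner[OF f_bound]) (use s b in auto)
      moreover have "diag (\<lambda>b. vector_derivative (relax (lam b)) (at s)) x \<bullet> b = vector_derivative (relax (lam b)) (at s) * (x \<bullet> b)"
        by (rule diag_inner[OF mode_derivative_bound]) (use s b in auto)
      ultimately show "diag (?f s) x \<bullet> b = caputo_integrand (\<rho> j) (evolution x) t s \<bullet> b"
        using vector_derivative_at[OF evolution_has_derivative[OF s(1), of x]]
        by (simp add: caputo_integrand_def)
    qed
    ultimately show ?thesis by simp
  qed
  have int: "(caputo_integrand (\<rho> j) (evolution x) t has_integral diag (?g t) x - diag (?g 0) x) {0..t}"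
    by (rule fundamental_theorem_of_calculus_interior[OF _ g_cont]) (use t g_deriv in auto)
  moreover have "diag (?g 0) x = 0"
    by (rule total) (use g_inner[of _ 0] t in auto)
  ultimately have int: "(caputo_integrand (\<rho> j) (evolution x) t has_integral diag (?g t) x) {0..t}" by simp
  then show "caputo_deriv_exists (\<rho> j) (evolution x) t"
    using differentiableI_vector[OF evolution_has_derivative]
    by (auto simp: caputo_deriv_exists_def has_integral_integrable)
  show "caputo_deriv (\<rho> j) (evolution x) t \<bullet> b = caputo_deriv (\<rho> j) (relax (lam b)) t * (x \<bullet> b)" if "b \<in> B"
    using g_inner[OF that, of t] t by (simp add: caputo_deriv_def integral_unique[OF int])
qed

lemma evolution_solves:
  assumes "evolution x T = \<Phi>"
  shows "backward_solution D A M \<rho> q T \<Phi> (evolution x)"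
  unfolding backward_solution_def
proof (intro conjI ballI)
  fix t assume "t \<in> {0<..<T}"
  then have t: "t > 0" by simp
  show "evolution x t \<in> D" by (rule evolution_in_domain[OF t])
  show "caputo_deriv_exists (\<rho> j) (evolution x) t" if "j \<in> {1..M}" for j
    by (rule evolution_caputo[OF t that])
  show "(\<Sum>j=1..M. q j *\<^sub>R caputo_deriv (\<rho> j) (evolution x) t) + A (evolution x t) = 0"
  proof (rule total)
    fix b assume b: "b \<in> B"
    have "(\<Sum>j=1..M. q j *\<^sub>R caputo_deriv (\<rho> j) (evolution x) t) \<bullet> b = multi_caputo (relax (lam b)) t * (x \<bullet> b)"
      unfolding inner_sum_left multi_caputo_def sum_distrib_right
      using evolution_caputo(2)[OF t _ b] by (intro sum.cong) auto
    then show "((\<Sum>j=1..M. q j *\<^sub>R caputo_deriv (\<rho> j) (evolution x) t) + A (evolution x t)) \<bullet> b = 0"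
      using evolution_in_domain(2)[OF t b] relaxation_equation[OF lam_pos[OF b] relaxation_mode[OF b] t]
      by (simp add: inner_add_left)
  qed
qed (use assms evolution_continuous in auto)

text \<open>
  The initial value is \<open>A \<Phi>\<close> with its coefficients divided by \<open>lam b * relax (lam b) T\<close>, which is
  bounded away from zero.
\<close>

theorem backward_problem_solvable:
  assumes \<Phi>: "\<Phi> \<in> D"
  shows "\<exists>u. backward_solution D A M \<rho> q T \<Phi> u"
proof -
  obtain C1 C2 where C1: "C1 > 0" "\<And>b. b \<in> B \<Longrightarrow> C1 \<le> lam b * relax (lam b) T"
    using mode_bounds by metis
  let ?m = "\<lambda>b. 1 / (lam b * relax (lam b) T)"
  have m: "\<bar>?m b\<bar> \<le> 1 / C1" if "b \<in> B" for b
    using C1(1) C1(2)[OF that] by (simp add: abs_of_nonneg divide_left_mono)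
  have "evolution (diag ?m (A \<Phi>)) T = \<Phi>"
  proof (rule eq_if_coefficients_eq)
    fix b assume b: "b \<in> B"
    have "diag ?m (A \<Phi>) \<bullet> b = ?m b * (lam b * (\<Phi> \<bullet> b))"
      using diag_inner[OF m b] A_coefficient[OF \<Phi> b] by simp
    moreover have "lam b * relax (lam b) T \<noteq> 0" using C1(1) C1(2)[OF b] by auto
    ultimately show "evolution (diag ?m (A \<Phi>)) T \<bullet> b = \<Phi> \<bullet> b"
      using evolution_inner[OF b, of T] T_pos by simp
  qed
  from evolution_solves[OF this] show ?thesis by blast
qed

theorem backward_solution_unique:
  assumes u: "backward_solution D A M \<rho> q T \<Phi> u" and w: "backward_solution D A M \<rho> q T \<Phi> w"
    and t: "0 \<le> t" "t \<le> T"
  shows "u t = w t"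
proof (rule eq_if_coefficients_eq)
  fix b assume b: "b \<in> B"
  note coef = solution_coefficient[OF u b] solution_coefficient[OF w b]
  have "u T = w T" using u w by (simp add: backward_solution_def)
  then have "(u 0 \<bullet> b) * relax (lam b) T = (w 0 \<bullet> b) * relax (lam b) T"
    using coef[of T] T_pos by (metis less_imp_le order_refl)
  moreover have "relax (lam b) T > 0"
    using relaxation_pos[OF lam_pos[OF b] relaxation_mode[OF b]] T_pos by simp
  ultimately show "u t \<bullet> b = w t \<bullet> b" using coef[OF t] by simp
qed

theorem backward_solution_estimates:
  "\<exists>C1 C2 :: real. C1 > 0 \<and> C2 > 0 \<and> (\<forall>\<Phi>\<in>D. \<forall>u. backward_solution D A M \<rho> q T \<Phi> u \<longrightarrow>
     C1 * norm (u 0) \<le> norm (A (u T)) \<and> norm (A (u T)) \<le> C2 * norm (u 0))"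
proof -
  obtain C1 C2 where C: "C1 > 0" "C2 > 0" and lower: "\<And>b. b \<in> B \<Longrightarrow> C1 \<le> lam b * relax (lam b) T"
    and upper: "\<And>b. b \<in> B \<Longrightarrow> lam b * relax (lam b) T \<le> C2"
    using mode_bounds by metis
  have "C1 * norm (u 0) \<le> norm (A (u T)) \<and> norm (A (u T)) \<le> C2 * norm (u 0)"
    if \<Phi>: "\<Phi> \<in> D" and u: "backward_solution D A M \<rho> q T \<Phi> u" for \<Phi> u
  proof -
    have uT: "u T \<in> D" using u \<Phi> by (simp add: backward_solution_def)
    have coef: "\<bar>A (u T) \<bullet> b\<bar> = lam b * relax (lam b) T * \<bar>u 0 \<bullet> b\<bar>" if b: "b \<in> B" for b
    proof -
      have "A (u T) \<bullet> b = lam b * relax (lam b) T * (u 0 \<bullet> b)"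
        using A_coefficient[OF uT b] solution_coefficient[OF u b, of T] T_pos by simp
      moreover have "lam b * relax (lam b) T > 0" using C(1) lower[OF b] by linarith
      ultimately show ?thesis by (simp only: abs_mult[of "lam b * relax (lam b) T"] abs_of_pos)
    qed
    have "norm (u 0) \<le> 1 / C1 * norm (A (u T))"
    proof (rule norm_le_if_coefficients_le)
      fix b assume b: "b \<in> B"
      have "C1 * \<bar>u 0 \<bullet> b\<bar> \<le> \<bar>A (u T) \<bullet> b\<bar>"
        unfolding coef[OF b] by (intro mult_right_mono lower b) simp
      then show "\<bar>u 0 \<bullet> b\<bar> \<le> 1 / C1 * \<bar>A (u T) \<bullet> b\<bar>" using C(1) by (simp add: field_simps)
    qed (use C in simp)
    moreover have "norm (A (u T)) \<le> C2 * norm (u 0)"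
      by (rule norm_le_if_coefficients_le) (use C in \<open>auto simp: coef intro!: mult_right_mono upper\<close>)
    ultimately show ?thesis using C(1) by (simp add: field_simps)
  qed
  with C show ?thesis by blast
qed

end

theorem theorem4p1:
  fixes D :: "'h::{real_inner, complete_space, second_countable_topology} set"
    and A :: "'h \<Rightarrow> 'h"
    and M :: nat and \<rho> q :: "nat \<Rightarrow> real" and T :: real
  assumes "self_adjoint_operator D A"
    and "positive_operator D A"
    and "has_compact_inverse D A"
    and "T > 0"
    and "M \<ge> 1"
    and "0 < \<rho> M" and "\<And>j. 1 \<le> j \<Longrightarrow> j < M \<Longrightarrow> \<rho> (Suc j) < \<rho> j" and "\<rho> 1 < 1"
    and "\<And>j. 1 \<le> j \<Longrightarrow> j \<le> M \<Longrightarrow> q j > 0" and "q 1 = 1"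
  shows "(\<forall>\<Phi>\<in>D. (\<exists>u. backward_solution D A M \<rho> q T \<Phi> u) \<and>
            (\<forall>u w. backward_solution D A M \<rho> q T \<Phi> u \<longrightarrow> backward_solution D A M \<rho> q T \<Phi> w \<longrightarrow>
               (\<forall>t\<in>{0..T}. u t = w t))) \<and>
         (\<exists>C1 C2 :: real. C1 > 0 \<and> C2 > 0 \<and>
            (\<forall>\<Phi>\<in>D. \<forall>u. backward_solution D A M \<rho> q T \<Phi> u \<longrightarrow>
               C1 * norm (u 0) \<le> norm (A (u T)) \<and> norm (A (u T)) \<le> C2 * norm (u 0)))"
proof -
  have decr: "\<rho> k < \<rho> j" if "1 \<le> j" "j < k" "k \<le> M" for j k
    using that(2,3)
  proof (induction k)
    case (Suc k)
    then have "\<rho> (Suc k) < \<rho> k" using assms(7)[of k] \<open>1 \<le> j\<close> by simp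
    with Suc show ?case by (cases "j = k") auto
  qed simp
  have orders: "0 < \<rho> j \<and> \<rho> j < 1" if "j \<in> {1..M}" for j
    using decr[of j M] decr[of 1 j] that assms(6,8) by (cases "j = 1"; cases "j = M") auto
  obtain B lam l0 where basis: "operator_eigenbasis B D A lam l0"
    by (rule operator_eigenbasis_exists[OF assms(1-3)])
  have "fractional_orders M \<rho> q"
    by standard (use assms(5,9) orders in auto)
  then have "ordered_fractional_orders M \<rho> q"
    by (intro ordered_fractional_orders.intro ordered_fractional_orders_axioms.intro)
       (use assms(10) decr[of 1] in auto)
  then have "fractional_evolution M \<rho> q B D A lam l0 T"
    using basis assms(4)
    by (intro fractional_evolution.intro fractional_evolution_axioms.intro)
  then interpret fractional_evolution M \<rho> q B D A lam l0 T .
  show ?thesis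
  proof (intro conjI ballI allI impI)
    show "\<exists>u. backward_solution D A M \<rho> q T \<Phi> u" if "\<Phi> \<in> D" for \<Phi>
      using that by (rule backward_problem_solvable)
    show "u t = w t" if "backward_solution D A M \<rho> q T \<Phi> u" "backward_solution D A M \<rho> q T \<Phi> w" "t \<in> {0..T}"
      for \<Phi> u w t
      using that by (intro backward_solution_unique[of \<Phi> u w t]) auto
  qed (rule backward_solution_estimates)
qed

end
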